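(* Let $R$ be a commutative Noetherian ring and let $(\mathcal X,\mathcal E)$ be an exact subcategory of $\operatorname{Mod}R$. Let $G:\mathcal X\to\operatorname{fl}(R)$ be an additive half-exact functor (covariant or contravariant), where $\operatorname{fl}(R)$ denotes the full subcategory of $\operatorname{mod}R$ consisting of finite length modules. Set $\mathcal E^G:=\{\sigma\in\mathcal E: G(\sigma)\text{ is a short exact sequence of modules}\}$. Then $(\mathcal X,\mathcal E^G)$ is an exact subcategory of $\operatorname{Mod}R$.
   Context: $\operatorname{Mod}R$ (resp. $\operatorname{mod}R$) is the category of all (resp. finitely generated) $R$-modules; $\operatorname{Mod}R$ carries its standard exact structure of all short exact sequences. An exact subcategory of $\operatorname{Mod}R$ is a pair $(\mathcal X,\mathcal E)$ where $\mathcal X$ is a full additive subcategory closed under isomorphism and $\mathcal E$ is a class of short exact sequences of modules in $\mathcal X$ such that $(\mathcal X,\mathcal E)$ is a (Quillen) exact category. $G$ is half-exact if, for every $0\to M\to N\to L\to0$ in $\mathcal E$, the sequence $G(M)\to G(N)\to G(L)$ (resp. $G(L)\to G(N)\to G(M)$ in the contravariant case) is exact at $G(N)$. *)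

theory Defs
  imports "HOL-Algebra.Module" "HOL-Algebra.Ring_Divisibility"
begin

section \<open>Homomorphisms of modules\<close>

text \<open>
  A homomorphism is an extensional function (undefined outside the carrier of its domain), so that
  equality of morphisms is equality of functions.  Composition of \<open>f\<close> from \<open>A\<close>
  with \<open>g\<close> is \<open>compose (carrier A) g f\<close>.
\<close>

definition mod_hom ::
  "('r, 'x) ring_scheme \<Rightarrow> ('r, 'm) module \<Rightarrow> ('r, 'n) module \<Rightarrow> ('m \<Rightarrow> 'n) set" where
  "mod_hom R M N = {f \<in> carrier M \<rightarrow>\<^sub>E carrier N.
     (\<forall>x\<in>carrier M. \<forall>y\<in>carrier M. f (x \<oplus>\<^bsub>M\<^esub> y) = f x \<oplus>\<^bsub>N\<^esub> f y) \<and>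
     (\<forall>a\<in>carrier R. \<forall>x\<in>carrier M. f (a \<odot>\<^bsub>M\<^esub> x) = a \<odot>\<^bsub>N\<^esub> f x)}"

definition mod_iso ::
  "('r, 'x) ring_scheme \<Rightarrow> ('r, 'm) module \<Rightarrow> ('r, 'n) module \<Rightarrow> ('m \<Rightarrow> 'n) set" where
  "mod_iso R M N = {f \<in> mod_hom R M N. bij_betw f (carrier M) (carrier N)}"

definition id_hom :: "('r, 'm) module \<Rightarrow> ('m \<Rightarrow> 'm)" where
  "id_hom M = (\<lambda>x\<in>carrier M. x)"

definition zero_hom :: "('r, 'm) module \<Rightarrow> ('r, 'n) module \<Rightarrow> ('m \<Rightarrow> 'n)" where
  "zero_hom M N = (\<lambda>x\<in>carrier M. \<zero>\<^bsub>N\<^esub>)"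

definition add_hom ::
  "('r, 'm) module \<Rightarrow> ('r, 'n) module \<Rightarrow> ('m \<Rightarrow> 'n) \<Rightarrow> ('m \<Rightarrow> 'n) \<Rightarrow> ('m \<Rightarrow> 'n)" where
  "add_hom M N f g = (\<lambda>x\<in>carrier M. f x \<oplus>\<^bsub>N\<^esub> g x)"

section \<open>Finite length modules\<close>

definition fin_gen_module :: "('r, 'x) ring_scheme \<Rightarrow> ('r, 'm) module \<Rightarrow> bool" where
  "fin_gen_module R M \<longleftrightarrow> module R M \<and>
     (\<exists>S \<subseteq> carrier M. finite S \<and> (\<forall>H. submodule H R M \<and> S \<subseteq> H \<longrightarrow> H = carrier M))"

text \<open>Finite length: there is a composition series \<open>0 = S 0 \<subset> \<dots> \<subset> S n = M\<close> without refinements.\<close>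

definition finite_length_module :: "('r, 'x) ring_scheme \<Rightarrow> ('r, 'm) module \<Rightarrow> bool" where
  "finite_length_module R M \<longleftrightarrow> module R M \<and>
     (\<exists>n (S :: nat \<Rightarrow> 'm set).
        S 0 = {\<zero>\<^bsub>M\<^esub>} \<and> S n = carrier M \<and> (\<forall>k\<le>n. submodule (S k) R M) \<and>
        (\<forall>k<n. S k \<subset> S (Suc k) \<and> \<not> (\<exists>H. submodule H R M \<and> S k \<subset> H \<and> H \<subset> S (Suc k))))"

definition fl :: "('r, 'x) ring_scheme \<Rightarrow> ('r, 'm) module set" where
  "fl R = {M. fin_gen_module R M \<and> finite_length_module R M}"

section \<open>Short exact sequences\<close>

text \<open>The tuple \<open>(A, i, B, p, C)\<close> stands for the sequence \<open>A \<rightarrow> B \<rightarrow> C\<close> with maps \<open>i\<close> and \<open>p\<close>.\<close>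

type_synonym ('r, 'm) mod_seq =
  "('r, 'm) module \<times> ('m \<Rightarrow> 'm) \<times> ('r, 'm) module \<times> ('m \<Rightarrow> 'm) \<times> ('r, 'm) module"

fun exact_middle :: "('r, 'm) mod_seq \<Rightarrow> bool" where
  "exact_middle (A, i, B, p, C) \<longleftrightarrow> i ` carrier A = a_kernel B C p"

fun short_exact :: "('r, 'x) ring_scheme \<Rightarrow> ('r, 'm) mod_seq \<Rightarrow> bool" where
  "short_exact R (A, i, B, p, C) \<longleftrightarrow>
     module R A \<and> module R B \<and> module R C \<and> i \<in> mod_hom R A B \<and> p \<in> mod_hom R B C \<and>
     inj_on i (carrier A) \<and> exact_middle (A, i, B, p, C) \<and> p ` carrier B = carrier C"

section \<open>Exact subcategories of the category of all modules\<close>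

text \<open>
  A full subcategory is given by its class \<open>X\<close> of objects; all universal properties below
  range over objects of \<open>X\<close> only.
\<close>

definition biproduct ::
  "('r, 'x) ring_scheme \<Rightarrow> ('r, 'm) module \<Rightarrow> ('r, 'm) module \<Rightarrow> ('r, 'm) module \<Rightarrow> bool" where
  "biproduct R M N P \<longleftrightarrow>
     (\<exists>i\<in>mod_hom R M P. \<exists>j\<in>mod_hom R N P. \<exists>p\<in>mod_hom R P M. \<exists>q\<in>mod_hom R P N.
        compose (carrier M) p i = id_hom M \<and> compose (carrier N) q j = id_hom N \<and>
        compose (carrier N) p j = zero_hom N M \<and> compose (carrier M) q i = zero_hom M N \<and>
        add_hom P P (compose (carrier P) i p) (compose (carrier P) j q) = id_hom P)"

definition additive_subcategory :: "('r, 'x) ring_scheme \<Rightarrow> ('r, 'm) module set \<Rightarrow> bool" where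
  "additive_subcategory R X \<longleftrightarrow>
     (\<forall>M\<in>X. module R M) \<and>
     (\<exists>Z\<in>X. carrier Z = {\<zero>\<^bsub>Z\<^esub>}) \<and>
     (\<forall>M\<in>X. \<forall>N\<in>X. \<exists>P\<in>X. biproduct R M N P)"

definition iso_closed :: "('r, 'x) ring_scheme \<Rightarrow> ('r, 'm) module set \<Rightarrow> bool" where
  "iso_closed R X \<longleftrightarrow> (\<forall>M\<in>X. \<forall>N. module R N \<and> mod_iso R M N \<noteq> {} \<longrightarrow> N \<in> X)"

definition is_kernel ::
  "('r, 'x) ring_scheme \<Rightarrow> ('r, 'm) module set \<Rightarrow> ('r, 'm) mod_seq \<Rightarrow> bool" where
  "is_kernel R X = (\<lambda>(A, i, B, p, C).
     compose (carrier A) p i = zero_hom A C \<and>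
     (\<forall>T\<in>X. \<forall>f\<in>mod_hom R T B. compose (carrier T) p f = zero_hom T C \<longrightarrow>
        (\<exists>!g\<in>mod_hom R T A. compose (carrier T) i g = f)))"

definition is_cokernel ::
  "('r, 'x) ring_scheme \<Rightarrow> ('r, 'm) module set \<Rightarrow> ('r, 'm) mod_seq \<Rightarrow> bool" where
  "is_cokernel R X = (\<lambda>(A, i, B, p, C).
     compose (carrier A) p i = zero_hom A C \<and>
     (\<forall>T\<in>X. \<forall>f\<in>mod_hom R B T. compose (carrier A) f i = zero_hom A T \<longrightarrow>
        (\<exists>!g\<in>mod_hom R C T. compose (carrier B) g p = f)))"

definition kernel_cokernel_pair ::
  "('r, 'x) ring_scheme \<Rightarrow> ('r, 'm) module set \<Rightarrow> ('r, 'm) mod_seq \<Rightarrow> bool" where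
  "kernel_cokernel_pair R X = (\<lambda>(A, i, B, p, C).
     A \<in> X \<and> B \<in> X \<and> C \<in> X \<and> i \<in> mod_hom R A B \<and> p \<in> mod_hom R B C \<and>
     is_kernel R X (A, i, B, p, C) \<and> is_cokernel R X (A, i, B, p, C))"

definition seq_isomorphic ::
  "('r, 'x) ring_scheme \<Rightarrow> ('r, 'm) mod_seq \<Rightarrow> ('r, 'm) mod_seq \<Rightarrow> bool" where
  "seq_isomorphic R = (\<lambda>(A, i, B, p, C) (A', i', B', p', C').
     \<exists>a\<in>mod_iso R A A'. \<exists>b\<in>mod_iso R B B'. \<exists>c\<in>mod_iso R C C'.
       compose (carrier A) b i = compose (carrier A) i' a \<and>
       compose (carrier B) c p = compose (carrier B) p' b)"

definition seq_in :: "('r, 'x) ring_scheme \<Rightarrow> ('r, 'm) module set \<Rightarrow> ('r, 'm) mod_seq \<Rightarrow> bool" where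
  "seq_in R X = (\<lambda>(A, i, B, p, C).
     A \<in> X \<and> B \<in> X \<and> C \<in> X \<and> i \<in> mod_hom R A B \<and> p \<in> mod_hom R B C)"

definition adm_monic ::
  "('r, 'm) mod_seq set \<Rightarrow> ('r, 'm) module \<Rightarrow> ('r, 'm) module \<Rightarrow> ('m \<Rightarrow> 'm) \<Rightarrow> bool" where
  "adm_monic E A B i \<longleftrightarrow> (\<exists>p C. (A, i, B, p, C) \<in> E)"

definition adm_epic ::
  "('r, 'm) mod_seq set \<Rightarrow> ('r, 'm) module \<Rightarrow> ('r, 'm) module \<Rightarrow> ('m \<Rightarrow> 'm) \<Rightarrow> bool" where
  "adm_epic E B C p \<longleftrightarrow> (\<exists>A i. (A, i, B, p, C) \<in> E)"

text \<open>\<open>f' \<circ> i = i' \<circ> f\<close> with \<open>i : A \<rightarrow> B\<close>, \<open>f : A \<rightarrow> A'\<close>, \<open>i' : A' \<rightarrow> B'\<close>, \<open>f' : B \<rightarrow> B'\<close>.\<close>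

definition is_pushout ::
  "('r, 'x) ring_scheme \<Rightarrow> ('r, 'm) module set \<Rightarrow>
   ('r, 'm) module \<Rightarrow> ('r, 'm) module \<Rightarrow> ('r, 'm) module \<Rightarrow> ('r, 'm) module \<Rightarrow>
   ('m \<Rightarrow> 'm) \<Rightarrow> ('m \<Rightarrow> 'm) \<Rightarrow> ('m \<Rightarrow> 'm) \<Rightarrow> ('m \<Rightarrow> 'm) \<Rightarrow> bool" where
  "is_pushout R X A B A' B' i f i' f' \<longleftrightarrow>
     i' \<in> mod_hom R A' B' \<and> f' \<in> mod_hom R B B' \<and>
     compose (carrier A) f' i = compose (carrier A) i' f \<and>
     (\<forall>T\<in>X. \<forall>u\<in>mod_hom R B T. \<forall>v\<in>mod_hom R A' T.
        compose (carrier A) u i = compose (carrier A) v f \<longrightarrow>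
        (\<exists>!w\<in>mod_hom R B' T. compose (carrier B) w f' = u \<and> compose (carrier A') w i' = v))"

text \<open>\<open>p \<circ> f' = f \<circ> p'\<close> with \<open>p : B \<rightarrow> C\<close>, \<open>f : C' \<rightarrow> C\<close>, \<open>p' : B' \<rightarrow> C'\<close>, \<open>f' : B' \<rightarrow> B\<close>.\<close>

definition is_pullback ::
  "('r, 'x) ring_scheme \<Rightarrow> ('r, 'm) module set \<Rightarrow>
   ('r, 'm) module \<Rightarrow> ('r, 'm) module \<Rightarrow> ('r, 'm) module \<Rightarrow> ('r, 'm) module \<Rightarrow>
   ('m \<Rightarrow> 'm) \<Rightarrow> ('m \<Rightarrow> 'm) \<Rightarrow> ('m \<Rightarrow> 'm) \<Rightarrow> ('m \<Rightarrow> 'm) \<Rightarrow> bool" where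
  "is_pullback R X B C B' C' p f p' f' \<longleftrightarrow>
     p' \<in> mod_hom R B' C' \<and> f' \<in> mod_hom R B' B \<and>
     compose (carrier B') p f' = compose (carrier B') f p' \<and>
     (\<forall>T\<in>X. \<forall>u\<in>mod_hom R T B. \<forall>v\<in>mod_hom R T C'.
        compose (carrier T) p u = compose (carrier T) f v \<longrightarrow>
        (\<exists>!w\<in>mod_hom R T B'. compose (carrier T) f' w = u \<and> compose (carrier T) p' w = v))"

text \<open>Quillen's axioms, in the self-dual form of Keller and Buehler.\<close>

definition exact_structure ::
  "('r, 'x) ring_scheme \<Rightarrow> ('r, 'm) module set \<Rightarrow> ('r, 'm) mod_seq set \<Rightarrow> bool" where
  "exact_structure R X E \<longleftrightarrow>
     (\<forall>\<sigma>\<in>E. kernel_cokernel_pair R X \<sigma>) \<and>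
     (\<forall>\<sigma>\<in>E. \<forall>\<tau>. seq_in R X \<tau> \<and> seq_isomorphic R \<sigma> \<tau> \<longrightarrow> \<tau> \<in> E) \<and>
     (\<forall>A\<in>X. adm_monic E A A (id_hom A)) \<and>
     (\<forall>A\<in>X. adm_epic E A A (id_hom A)) \<and>
     (\<forall>A B C f g. adm_monic E A B f \<and> adm_monic E B C g \<longrightarrow>
        adm_monic E A C (compose (carrier A) g f)) \<and>
     (\<forall>A B C f g. adm_epic E A B f \<and> adm_epic E B C g \<longrightarrow>
        adm_epic E A C (compose (carrier A) g f)) \<and>
     (\<forall>A B i. adm_monic E A B i \<longrightarrow> (\<forall>A'\<in>X. \<forall>f\<in>mod_hom R A A'.
        \<exists>B'\<in>X. \<exists>i' f'. is_pushout R X A B A' B' i f i' f' \<and> adm_monic E A' B' i')) \<and>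
     (\<forall>B C p. adm_epic E B C p \<longrightarrow> (\<forall>C'\<in>X. \<forall>f\<in>mod_hom R C' C.
        \<exists>B'\<in>X. \<exists>p' f'. is_pullback R X B C B' C' p f p' f' \<and> adm_epic E B' C' p'))"

definition exact_subcategory ::
  "('r, 'x) ring_scheme \<Rightarrow> ('r, 'm) module set \<Rightarrow> ('r, 'm) mod_seq set \<Rightarrow> bool" where
  "exact_subcategory R X E \<longleftrightarrow>
     additive_subcategory R X \<and> iso_closed R X \<and>
     (\<forall>\<sigma>\<in>E. seq_in R X \<sigma> \<and> short_exact R \<sigma>) \<and>
     exact_structure R X E"

section \<open>Additive functors\<close>

text \<open>
  A functor has an object part \<open>Go\<close> and a morphism part \<open>Gm\<close>, where \<open>Gm M N f\<close> is the value
  at \<open>f : M \<rightarrow> N\<close>; the underlying function \<open>f\<close> alone does not determine \<open>M\<close> and \<open>N\<close>.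
\<close>

definition additive_covariant ::
  "('r, 'x) ring_scheme \<Rightarrow> ('r, 'm) module set \<Rightarrow> ('r, 'n) module set \<Rightarrow>
   (('r, 'm) module \<Rightarrow> ('r, 'n) module) \<Rightarrow>
   (('r, 'm) module \<Rightarrow> ('r, 'm) module \<Rightarrow> ('m \<Rightarrow> 'm) \<Rightarrow> ('n \<Rightarrow> 'n)) \<Rightarrow> bool" where
  "additive_covariant R X Y Go Gm \<longleftrightarrow>
     (\<forall>M\<in>X. Go M \<in> Y) \<and>
     (\<forall>M\<in>X. \<forall>N\<in>X. \<forall>f\<in>mod_hom R M N. Gm M N f \<in> mod_hom R (Go M) (Go N)) \<and>
     (\<forall>M\<in>X. Gm M M (id_hom M) = id_hom (Go M)) \<and>
     (\<forall>L\<in>X. \<forall>M\<in>X. \<forall>N\<in>X. \<forall>f\<in>mod_hom R L M. \<forall>g\<in>mod_hom R M N.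
        Gm L N (compose (carrier L) g f) = compose (carrier (Go L)) (Gm M N g) (Gm L M f)) \<and>
     (\<forall>M\<in>X. \<forall>N\<in>X. \<forall>f\<in>mod_hom R M N. \<forall>g\<in>mod_hom R M N.
        Gm M N (add_hom M N f g) = add_hom (Go M) (Go N) (Gm M N f) (Gm M N g))"

definition additive_contravariant ::
  "('r, 'x) ring_scheme \<Rightarrow> ('r, 'm) module set \<Rightarrow> ('r, 'n) module set \<Rightarrow>
   (('r, 'm) module \<Rightarrow> ('r, 'n) module) \<Rightarrow>
   (('r, 'm) module \<Rightarrow> ('r, 'm) module \<Rightarrow> ('m \<Rightarrow> 'm) \<Rightarrow> ('n \<Rightarrow> 'n)) \<Rightarrow> bool" where
  "additive_contravariant R X Y Go Gm \<longleftrightarrow>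
     (\<forall>M\<in>X. Go M \<in> Y) \<and>
     (\<forall>M\<in>X. \<forall>N\<in>X. \<forall>f\<in>mod_hom R M N. Gm M N f \<in> mod_hom R (Go N) (Go M)) \<and>
     (\<forall>M\<in>X. Gm M M (id_hom M) = id_hom (Go M)) \<and>
     (\<forall>L\<in>X. \<forall>M\<in>X. \<forall>N\<in>X. \<forall>f\<in>mod_hom R L M. \<forall>g\<in>mod_hom R M N.
        Gm L N (compose (carrier L) g f) = compose (carrier (Go N)) (Gm L M f) (Gm M N g)) \<and>
     (\<forall>M\<in>X. \<forall>N\<in>X. \<forall>f\<in>mod_hom R M N. \<forall>g\<in>mod_hom R M N.
        Gm M N (add_hom M N f g) = add_hom (Go N) (Go M) (Gm M N f) (Gm M N g))"

fun covariant_image ::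
  "(('r, 'm) module \<Rightarrow> ('r, 'n) module) \<Rightarrow>
   (('r, 'm) module \<Rightarrow> ('r, 'm) module \<Rightarrow> ('m \<Rightarrow> 'm) \<Rightarrow> ('n \<Rightarrow> 'n)) \<Rightarrow>
   ('r, 'm) mod_seq \<Rightarrow> ('r, 'n) mod_seq" where
  "covariant_image Go Gm (A, i, B, p, C) = (Go A, Gm A B i, Go B, Gm B C p, Go C)"

fun contravariant_image ::
  "(('r, 'm) module \<Rightarrow> ('r, 'n) module) \<Rightarrow>
   (('r, 'm) module \<Rightarrow> ('r, 'm) module \<Rightarrow> ('m \<Rightarrow> 'm) \<Rightarrow> ('n \<Rightarrow> 'n)) \<Rightarrow>
   ('r, 'm) mod_seq \<Rightarrow> ('r, 'n) mod_seq" where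
  "contravariant_image Go Gm (A, i, B, p, C) = (Go C, Gm B C p, Go B, Gm A B i, Go A)"

text \<open>Here \<open>G\<close> is the induced map on sequences, of either variance.\<close>

definition half_exact ::
  "('r, 'm) mod_seq set \<Rightarrow> (('r, 'm) mod_seq \<Rightarrow> ('r, 'n) mod_seq) \<Rightarrow> bool" where
  "half_exact E G \<longleftrightarrow> (\<forall>\<sigma>\<in>E. exact_middle (G \<sigma>))"

definition exact_part ::
  "('r, 'x) ring_scheme \<Rightarrow> ('r, 'm) mod_seq set \<Rightarrow>
   (('r, 'm) mod_seq \<Rightarrow> ('r, 'n) mod_seq) \<Rightarrow> ('r, 'm) mod_seq set" where
  "exact_part R E G = {\<sigma> \<in> E. short_exact R (G \<sigma>)}"

end

theory Submission
  imports Defs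
begin

text \<open>
  Half-exactness alone suffices: a conflation \<open>A \<rightarrow> B \<rightarrow> C\<close> lies in the exact part iff \<open>G\<close> sends its
  inflation to an injection and its deflation to a surjection (for covariant \<open>G\<close>).  Closure under
  composition is a diagram chase along the conflation \<open>B/A \<rightarrow> C/A \<rightarrow> C/B\<close> supplied by Noether's
  isomorphism; closure under pushouts is a chase along the conflation \<open>A \<rightarrow> B \<oplus> A' \<rightarrow> B'\<close> attached
  to a pushout square.  The exact structure is treated in an abstract preadditive category, where
  the dual statements are instances of the original ones and a contravariant functor is a covariant
  functor on the opposite category.
\<close>

text \<open>Universal properties inside the subcategory are tested only against its own objects, so
  kernels, cokernels and pushouts are handled there by factorisation alone; elements are chased only
  in the values of the functor. Half-exactness says nothing at the two ends of a sequence, so every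
  closure property has an easy half and a hard half. For a composite of inflations injectivity is
  immediate, and surjectivity onto the value at the quotient is the hard half; for a pushout it is
  the reverse. In each hard half the element to be controlled is moved into the middle term of an
  auxiliary conflation, the only place where half-exactness can be used. Duality acts on the
  categorical lemmas but not on these chases: passing to the opposite category turns a covariant
  functor into a contravariant one, so deflations and pullbacks get chases of their own.\<close>

section \<open>Preadditive categories and exact structures\<close>

text \<open>The category data are explicit arguments so that reversing source, target and
  composition yields pullbacks from the same formula. Uniqueness is stated as joint right
  cancellability of \<open>f'\<close> and \<open>i'\<close>, with no cocone mentioned, because any
  arrow out of the corner already induces one.\<close>

definition pushout_square ::
  "('a \<Rightarrow> bool) \<Rightarrow> ('a \<Rightarrow> 'o) \<Rightarrow> ('a \<Rightarrow> 'o) \<Rightarrow> ('a \<Rightarrow> 'a \<Rightarrow> 'a) \<Rightarrow> 'a \<Rightarrow> 'a \<Rightarrow> 'a \<Rightarrow> 'a \<Rightarrow> bool" where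
  "pushout_square arr src tgt cmp i f i' f' \<longleftrightarrow>
     arr i \<and> arr f \<and> arr i' \<and> arr f' \<and> src f = src i \<and> src f' = tgt i \<and> src i' = tgt f \<and>
     tgt i' = tgt f' \<and> cmp f' i = cmp i' f \<and>
     (\<forall>u v. arr u \<and> arr v \<and> src u = tgt i \<and> src v = tgt f \<and> tgt u = tgt v \<and> cmp u i = cmp v f \<longrightarrow>
        (\<exists>w. arr w \<and> src w = tgt i' \<and> tgt w = tgt u \<and> cmp w f' = u \<and> cmp w i' = v)) \<and>
     (\<forall>w w'. arr w \<and> arr w' \<and> src w = tgt i' \<and> src w' = tgt i' \<and> tgt w = tgt w' \<and>
        cmp w f' = cmp w' f' \<and> cmp w i' = cmp w' i' \<longrightarrow> w = w')"

text \<open>Partial operations are modelled by total ones whose laws are guarded by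
  \<open>arr\<close> and by matching endpoints. Several laws use a variable object with a premise
  such as \<open>A = src f\<close>, so that the simplifier can apply them when the endpoint is
  written in another way.\<close>

locale preadditive =
  fixes Ob :: "'o set" and arr :: "'a \<Rightarrow> bool" and src tgt :: "'a \<Rightarrow> 'o"
    and cmp :: "'a \<Rightarrow> 'a \<Rightarrow> 'a" (infixl "\<cdot>" 70)
    and one :: "'o \<Rightarrow> 'a" and zero :: "'o \<Rightarrow> 'o \<Rightarrow> 'a"
    and add :: "'a \<Rightarrow> 'a \<Rightarrow> 'a" (infixl "\<boxplus>" 65) and neg :: "'a \<Rightarrow> 'a"
  assumes ends [simp]: "arr f \<Longrightarrow> src f \<in> Ob" "arr f \<Longrightarrow> tgt f \<in> Ob"
    and one_typ [simp]: "A \<in> Ob \<Longrightarrow> arr (one A)" "A \<in> Ob \<Longrightarrow> src (one A) = A"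
      "A \<in> Ob \<Longrightarrow> tgt (one A) = A"
    and cmp_typ [simp]: "arr f \<Longrightarrow> arr g \<Longrightarrow> src g = tgt f \<Longrightarrow> arr (g \<cdot> f)"
      "arr f \<Longrightarrow> arr g \<Longrightarrow> src g = tgt f \<Longrightarrow> src (g \<cdot> f) = src f"
      "arr f \<Longrightarrow> arr g \<Longrightarrow> src g = tgt f \<Longrightarrow> tgt (g \<cdot> f) = tgt g"
    and cmp_assoc: "arr f \<Longrightarrow> arr g \<Longrightarrow> arr h \<Longrightarrow> src g = tgt f \<Longrightarrow> src h = tgt g \<Longrightarrow>
      (h \<cdot> g) \<cdot> f = h \<cdot> (g \<cdot> f)"
    and cmp_one [simp]: "arr f \<Longrightarrow> A = src f \<Longrightarrow> f \<cdot> one A = f"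
      "arr f \<Longrightarrow> A = tgt f \<Longrightarrow> one A \<cdot> f = f"
    and zero_typ [simp]: "A \<in> Ob \<Longrightarrow> B \<in> Ob \<Longrightarrow> arr (zero A B)"
      "A \<in> Ob \<Longrightarrow> B \<in> Ob \<Longrightarrow> src (zero A B) = A"
      "A \<in> Ob \<Longrightarrow> B \<in> Ob \<Longrightarrow> tgt (zero A B) = B"
    and add_typ [simp]:
      "arr f \<Longrightarrow> arr g \<Longrightarrow> src f = src g \<Longrightarrow> tgt f = tgt g \<Longrightarrow> arr (f \<boxplus> g)"
      "arr f \<Longrightarrow> arr g \<Longrightarrow> src f = src g \<Longrightarrow> tgt f = tgt g \<Longrightarrow> src (f \<boxplus> g) = src g"
      "arr f \<Longrightarrow> arr g \<Longrightarrow> src f = src g \<Longrightarrow> tgt f = tgt g \<Longrightarrow> tgt (f \<boxplus> g) = tgt g"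
    and neg_typ [simp]: "arr f \<Longrightarrow> arr (neg f)" "arr f \<Longrightarrow> src (neg f) = src f"
      "arr f \<Longrightarrow> tgt (neg f) = tgt f"
    and add_assoc: "arr f \<Longrightarrow> arr g \<Longrightarrow> arr h \<Longrightarrow> src f = src g \<Longrightarrow> tgt f = tgt g \<Longrightarrow>
      src g = src h \<Longrightarrow> tgt g = tgt h \<Longrightarrow> (f \<boxplus> g) \<boxplus> h = f \<boxplus> (g \<boxplus> h)"
    and add_comm: "arr f \<Longrightarrow> arr g \<Longrightarrow> src f = src g \<Longrightarrow> tgt f = tgt g \<Longrightarrow> f \<boxplus> g = g \<boxplus> f"
    and add_zero [simp]: "arr f \<Longrightarrow> A = src f \<Longrightarrow> B = tgt f \<Longrightarrow> f \<boxplus> zero A B = f"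
    and add_neg [simp]: "arr f \<Longrightarrow> f \<boxplus> neg f = zero (src f) (tgt f)"
    and cmp_add_left: "arr f \<Longrightarrow> arr g \<Longrightarrow> arr h \<Longrightarrow> src f = src g \<Longrightarrow> tgt f = tgt g \<Longrightarrow>
      src h = tgt g \<Longrightarrow> h \<cdot> (f \<boxplus> g) = h \<cdot> f \<boxplus> h \<cdot> g"
    and cmp_add_right: "arr f \<Longrightarrow> arr g \<Longrightarrow> arr h \<Longrightarrow> src f = src g \<Longrightarrow> tgt f = tgt g \<Longrightarrow>
      tgt h = src g \<Longrightarrow> (f \<boxplus> g) \<cdot> h = f \<cdot> h \<boxplus> g \<cdot> h"
begin

section \<open>Arithmetic of arrows\<close>

lemma add_zero_left [simp]: "arr f \<Longrightarrow> A = src f \<Longrightarrow> B = tgt f \<Longrightarrow> zero A B \<boxplus> f = f"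
  using add_comm [of "zero A B" f] by simp

lemma add_neg_left [simp]: "arr f \<Longrightarrow> neg f \<boxplus> f = zero (src f) (tgt f)"
  using add_comm [of "neg f" f] by simp

lemma add_neg_cancel [simp]:
  assumes "arr f" "arr g" "src f = src g" "tgt f = tgt g"
  shows "f \<boxplus> (neg f \<boxplus> g) = g" "neg f \<boxplus> (f \<boxplus> g) = g"
  using assms by (simp_all flip: add_assoc)

text \<open>Cancels one summand. It serves to show that a composite with a zero arrow is zero: by
  distributivity such a composite equals its own double.\<close>

lemma eq_zero_if_idem:
  assumes "arr f" "f \<boxplus> f = f"
  shows "f = zero (src f) (tgt f)"
  using add_neg_cancel(2) [of f f] assms by simp

lemma neg_unique:
  assumes "arr f" "arr g" "src f = src g" "tgt f = tgt g" "f \<boxplus> g = zero (src f) (tgt f)"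
  shows "g = neg f"
  using add_neg_cancel(2) [of f g] assms by simp

lemma add_cancel:
  assumes "arr f" "arr g" "arr h" "src f = src h" "tgt f = tgt h" "src g = src h" "tgt g = tgt h"
    "f \<boxplus> h = g \<boxplus> h"
  shows "f = g"
proof -
  have "(f \<boxplus> h) \<boxplus> neg h = (g \<boxplus> h) \<boxplus> neg h" using assms(8) by simp
  with assms(1-7) show ?thesis by (simp add: add_assoc)
qed

lemma cmp_zero [simp]:
  assumes "arr h" "A = src h" "B \<in> Ob"
  shows "h \<cdot> zero B A = zero B (tgt h)"
proof -
  have "h \<cdot> zero B A \<boxplus> h \<cdot> zero B A = h \<cdot> zero B A"
    using assms by (simp flip: cmp_add_left)
  with eq_zero_if_idem [OF _ this] assms show ?thesis by simp
qed

lemma zero_cmp [simp]: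
  assumes "arr h" "A = tgt h" "B \<in> Ob"
  shows "zero A B \<cdot> h = zero (src h) B"
proof -
  have "zero A B \<cdot> h \<boxplus> zero A B \<cdot> h = zero A B \<cdot> h"
    using assms by (simp flip: cmp_add_right)
  with eq_zero_if_idem [OF _ this] assms show ?thesis by simp
qed

lemma cmp_neg [simp]:
  assumes "arr f" "arr h" "src h = tgt f"
  shows "h \<cdot> neg f = neg (h \<cdot> f)"
  by (rule neg_unique) (use assms in \<open>simp_all flip: cmp_add_left\<close>)

lemma neg_cmp [simp]:
  assumes "arr f" "arr h" "src h = tgt f"
  shows "neg h \<cdot> f = neg (h \<cdot> f)"
  by (rule neg_unique) (use assms in \<open>simp_all flip: cmp_add_right\<close>)

lemma neg_zero [simp]: "A \<in> Ob \<Longrightarrow> B \<in> Ob \<Longrightarrow> neg (zero A B) = zero A B"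
  by (rule neg_unique [symmetric]) simp_all

lemma neg_neg [simp]: "arr f \<Longrightarrow> neg (neg f) = f"
  by (rule neg_unique [symmetric]) simp_all

section \<open>Isomorphisms, biproducts and pushout squares\<close>

definition inverses :: "'a \<Rightarrow> 'a \<Rightarrow> bool" where
  "inverses a a' \<longleftrightarrow> arr a \<and> arr a' \<and> src a' = tgt a \<and> tgt a' = src a \<and>
     a' \<cdot> a = one (src a) \<and> a \<cdot> a' = one (tgt a)"

definition biprod :: "'a \<Rightarrow> 'a \<Rightarrow> 'a \<Rightarrow> 'a \<Rightarrow> bool" where
  "biprod i j p q \<longleftrightarrow> arr i \<and> arr j \<and> arr p \<and> arr q \<and>
     tgt j = tgt i \<and> src p = tgt i \<and> src q = tgt i \<and> tgt p = src i \<and> tgt q = src j \<and>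
     p \<cdot> i = one (src i) \<and> q \<cdot> j = one (src j) \<and> p \<cdot> j = zero (src j) (src i) \<and>
     q \<cdot> i = zero (src i) (src j) \<and> i \<cdot> p \<boxplus> j \<cdot> q = one (tgt i)"

abbreviation "pushout \<equiv> pushout_square arr src tgt cmp"
abbreviation "pullback \<equiv> pushout_square arr tgt src (\<lambda>g f. f \<cdot> g)"

lemma pushoutD:
  assumes "pushout i f i' f'"
  shows "arr i" "arr f" "arr i'" "arr f'" "src f = src i" "src f' = tgt i" "src i' = tgt f"
    "tgt i' = tgt f'" "f' \<cdot> i = i' \<cdot> f"
  using assms by (simp_all add: pushout_square_def)

lemma pushout_factor:
  assumes "pushout i f i' f'" "arr u" "arr v" "src u = tgt i" "src v = tgt f" "tgt u = tgt v" "u \<cdot> i = v \<cdot> f"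
  obtains w where "arr w" "src w = tgt f'" "tgt w = tgt v" "w \<cdot> f' = u" "w \<cdot> i' = v"
  using assms unfolding pushout_square_def by metis

lemma pushout_jointly_epi:
  assumes "pushout i f i' f'" "arr w" "arr w'" "src w = tgt f'" "src w' = tgt f'" "tgt w = tgt w'"
    "w \<cdot> f' = w' \<cdot> f'" "w \<cdot> i' = w' \<cdot> i'"
  shows "w = w'"
  using assms unfolding pushout_square_def by metis

lemma inverses_one [simp]: "A \<in> Ob \<Longrightarrow> inverses (one A) (one A)"
  by (simp add: inverses_def)

text \<open>Rewriting with \<open>cmp_assoc\<close> nests composites to the right and hides the
  factor \<open>g \<cdot> f\<close> of a longer composite; this form still lets a known value of it
  be used.\<close>

lemma cmp_cmp:
  "g \<cdot> f = k \<Longrightarrow> arr f \<Longrightarrow> arr g \<Longrightarrow> arr h \<Longrightarrow> src g = tgt f \<Longrightarrow> src f = tgt h \<Longrightarrow> g \<cdot> (f \<cdot> h) = k \<cdot> h"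
  by (auto simp: cmp_assoc)

text \<open>Needed for duality: an isomorphism of sequences read in the opposite category points the
  other way, so its commuting squares must be restated for the inverse arrows.\<close>

lemma inverses_square:
  assumes a: "inverses a a'" and b: "inverses b b'" and "arr x" "arr y"
    "src x = src a" "tgt x = src b" "src y = tgt a" "tgt y = tgt b" "b \<cdot> x = y \<cdot> a"
  shows "b' \<cdot> y = x \<cdot> a'"
proof -
  have i: "arr a" "arr a'" "src a' = tgt a" "tgt a' = src a" "a \<cdot> a' = one (tgt a)"
    "arr b" "arr b'" "src b' = tgt b" "tgt b' = src b" "b' \<cdot> b = one (src b)"
    using a b by (simp_all add: inverses_def)
  have "b' \<cdot> y = b' \<cdot> (y \<cdot> (a \<cdot> a'))"
    using i assms(4,7) by simp
  also have "\<dots> = b' \<cdot> ((y \<cdot> a) \<cdot> a')"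
    using i assms(4,7) by (subst cmp_assoc) simp_all
  also have "\<dots> = b' \<cdot> (b \<cdot> (x \<cdot> a'))"
    using i assms(3-8) by (subst assms(9) [symmetric], subst cmp_assoc) simp_all
  also have "\<dots> = (b' \<cdot> b) \<cdot> (x \<cdot> a')"
    using i assms(3-8) by (subst cmp_assoc) simp_all
  also have "\<dots> = x \<cdot> a'"
    using i assms(3-8) by simp
  finally show ?thesis .
qed

lemma biprodD:
  assumes "biprod i j p q"
  shows "arr i" "arr j" "arr p" "arr q"
    "tgt j = tgt i" "src p = tgt i" "src q = tgt i" "tgt p = src i" "tgt q = src j"
    "p \<cdot> i = one (src i)" "q \<cdot> j = one (src j)" "p \<cdot> j = zero (src j) (src i)"
    "q \<cdot> i = zero (src i) (src j)" "i \<cdot> p \<boxplus> j \<cdot> q = one (tgt i)"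
  using assms by (simp_all add: biprod_def)

lemma biprod_cmp:
  assumes "biprod i j p q" "arr f"
  shows "tgt f = src i \<Longrightarrow> p \<cdot> (i \<cdot> f) = f" "tgt f = src j \<Longrightarrow> q \<cdot> (j \<cdot> f) = f"
    "tgt f = src j \<Longrightarrow> p \<cdot> (j \<cdot> f) = zero (src f) (src i)"
    "tgt f = src i \<Longrightarrow> q \<cdot> (i \<cdot> f) = zero (src f) (src j)"
  using assms(2) biprodD [OF assms(1)] by (simp_all add: cmp_cmp)

text \<open>Insert the identity of the biproduct, written as the sum of its two idempotents, after
  \<open>w\<close> and distribute. Thus an arrow out of a biproduct is determined by its two
  components.\<close>

lemma biprod_decompose:
  assumes "biprod i j p q" "arr w" "src w = tgt i"
  shows "w \<cdot> i \<cdot> p \<boxplus> w \<cdot> j \<cdot> q = w"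
proof -
  note b = biprodD [OF assms(1)]
  have "w \<cdot> (i \<cdot> p \<boxplus> j \<cdot> q) = w" using b(14) assms by simp
  with b(1-9) assms(2,3) show ?thesis by (simp add: cmp_add_left cmp_assoc)
qed

lemma biprod_jointly_epi:
  assumes "biprod i j p q" "arr w" "arr w'" "src w = tgt i" "src w' = tgt i"
    "w \<cdot> i = w' \<cdot> i" "w \<cdot> j = w' \<cdot> j"
  shows "w = w'"
  using biprod_decompose [OF assms(1,2,4)] biprod_decompose [OF assms(1,3,5)] assms(6,7)
  by metis

end

section \<open>Opposite categories and the axioms of an exact category\<close>

lemma preadditive_dual:
  assumes "preadditive Ob arr src tgt cmp uno nul pls neg"
  shows "preadditive Ob arr tgt src (\<lambda>g f. cmp f g) uno (\<lambda>A B. nul B A) pls neg"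
proof -
  interpret preadditive Ob arr src tgt cmp uno nul pls neg by (rule assms)
  show ?thesis
    by unfold_locales (auto simp: cmp_assoc add_assoc cmp_add_left cmp_add_right intro: add_comm)
qed

text \<open>A conflation is a relation between two arrows, so that dualising merely swaps its
  arguments. Kernel and cokernel properties are split into existence and cancellation; in this form
  the axioms pair off under duality.\<close>

locale exact_cat = preadditive +
  fixes conf :: "'b \<Rightarrow> 'b \<Rightarrow> bool"
  assumes conf_typ: "conf i p \<Longrightarrow> arr i" "conf i p \<Longrightarrow> arr p" "conf i p \<Longrightarrow> src p = tgt i"
    and conf_zero: "conf i p \<Longrightarrow> p \<cdot> i = zero (src i) (tgt p)"
    and conf_ker: "\<lbrakk>conf i p; arr f; tgt f = src p; p \<cdot> f = zero (src f) (tgt p)\<rbrakk> \<Longrightarrow>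
      \<exists>g. arr g \<and> src g = src f \<and> tgt g = src i \<and> i \<cdot> g = f"
    and conf_mono: "\<lbrakk>conf i p; arr g; arr h; src g = src h; tgt g = src i; tgt h = src i; i \<cdot> g = i \<cdot> h\<rbrakk> \<Longrightarrow> g = h"
    and conf_cok: "\<lbrakk>conf i p; arr f; src f = tgt i; f \<cdot> i = zero (src i) (tgt f)\<rbrakk> \<Longrightarrow>
      \<exists>g. arr g \<and> tgt g = tgt f \<and> src g = tgt p \<and> g \<cdot> p = f"
    and conf_epi: "\<lbrakk>conf i p; arr g; arr h; tgt g = tgt h; src g = tgt p; src h = tgt p; g \<cdot> p = h \<cdot> p\<rbrakk> \<Longrightarrow> g = h"
    and conf_iso: "\<lbrakk>conf i p; inverses a a'; inverses b b'; inverses c c'; arr i'; arr p';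
      src i' = tgt a; tgt i' = tgt b; src p' = tgt b; tgt p' = tgt c; src a = src i; src b = src p; src c = tgt p;
      b \<cdot> i = i' \<cdot> a; c \<cdot> p = p' \<cdot> b\<rbrakk> \<Longrightarrow> conf i' p'"
    and conf_one: "A \<in> Ob \<Longrightarrow> \<exists>p. conf (one A) p" "A \<in> Ob \<Longrightarrow> \<exists>i. conf i (one A)"
    and conf_mono_cmp: "\<lbrakk>conf f p; conf g q; src g = tgt f\<rbrakk> \<Longrightarrow> \<exists>r. conf (g \<cdot> f) r"
    and conf_epi_cmp: "\<lbrakk>conf i f; conf j g; src g = tgt f\<rbrakk> \<Longrightarrow> \<exists>k. conf k (g \<cdot> f)"
    and conf_pushout: "\<lbrakk>conf i p; arr f; src f = src i\<rbrakk> \<Longrightarrow> \<exists>i' f' p'. pushout i f i' f' \<and> conf i' p'"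
    and conf_pullback: "\<lbrakk>conf i p; arr f; tgt f = tgt p\<rbrakk> \<Longrightarrow> \<exists>p' f' i'. pullback p f p' f' \<and> conf i' p'"
    and biprod_exists: "\<lbrakk>A \<in> Ob; B \<in> Ob\<rbrakk> \<Longrightarrow> \<exists>i j p q. biprod i j p q \<and> src i = A \<and> src j = B"

text \<open>Each axiom is its own dual or has its dual on the list, except for invariance under
  isomorphism, where reversed arrows require passing to the inverse isomorphisms, and biproducts,
  where injections and projections trade places.\<close>

lemma exact_cat_dual:
  assumes "exact_cat Ob arr src tgt cmp uno nul pls neg conf"
  shows "exact_cat Ob arr tgt src (\<lambda>g f. cmp f g) uno (\<lambda>A B. nul B A) pls neg (\<lambda>p i. conf i p)"
proof -
  interpret exact_cat Ob arr src tgt cmp uno nul pls neg conf by (rule assms)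
  interpret op: preadditive Ob arr tgt src "\<lambda>g f. cmp f g" uno "\<lambda>A B. nul B A" pls neg
    by (rule preadditive_dual) unfold_locales
  have biprod: "op.biprod i j p q \<longleftrightarrow> biprod p q i j" for i j p q
    by (auto simp: op.biprod_def biprod_def)
  have inverses: "op.inverses a a' \<longleftrightarrow> inverses a' a" for a a'
    by (auto simp: op.inverses_def inverses_def)
  show ?thesis
  proof (unfold_locales, goal_cases)
    \<comment> \<open>Here \<open>a\<close>, \<open>b\<close>, \<open>c\<close> point from the new
      sequence to the old one in the original category, so \<open>conf_iso\<close> has to be fed
      with \<open>a'\<close>, \<open>b'\<close>, \<open>c'\<close>, and the order of the three
      components is reversed as well.\<close>
    case (9 i p a a' b b' c c' i' p')
    have inv: "inverses a' a" "inverses b' b" "inverses c' c"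
      using 9(2-4) by (simp_all add: inverses)
    have ti: "arr a" "arr b" "arr c" "arr a'" "arr b'" "arr c'" "src a = tgt a'" "src b = tgt b'" "src c = tgt c'"
      "tgt a = src a'" "tgt b = src b'" "tgt c = src c'"
      using inv by (simp_all add: inverses_def)
    have inv': "inverses a a'" "inverses b b'" "inverses c c'"
      using inv by (simp_all add: inverses_def)
    note ty = 9(5-13) ti conf_typ [OF 9(1)]
    have "cmp b' p = cmp p' c'"
      by (rule inverses_square [OF inv'(3,2)]) (use ty 9(15) in simp_all)
    moreover have "cmp a' i = cmp i' b'"
      by (rule inverses_square [OF inv'(2,1)]) (use ty 9(14) in simp_all)
    ultimately show ?case
      by (intro conf_iso [OF 9(1) inv(3,2,1)]) (use ty in simp_all)
  next
    case 14
    then show ?case by (rule conf_pullback)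
  next
    case 15
    then show ?case by (rule conf_pushout)
  next
    case (16 A B)
    then show ?case using biprod_exists [of A B] by (fastforce simp: biprod biprodD)
  qed (simp add: conf_typ; fail | rule conf_zero conf_cok conf_ker conf_epi conf_mono conf_one; assumption |
      metis conf_epi_cmp | metis conf_mono_cmp)+
qed

section \<open>Conflations built from pushouts\<close>

context exact_cat
begin

text \<open>Two cokernels of the same arrow factor through each other, and cancellation makes the
  factors mutually inverse; invariance under isomorphism then replaces \<open>p\<close> by
  \<open>q\<close>. Hence, once an arrow is known to be an inflation, any explicit cokernel of it
  may be used.\<close>

lemma cokernel_conf:
  assumes "conf i p" "arr q" "src q = tgt i" "q \<cdot> i = zero (src i) (tgt q)"
    and cok: "\<And>u. \<lbrakk>arr u; src u = tgt i; u \<cdot> i = zero (src i) (tgt u)\<rbrakk> \<Longrightarrow>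
      \<exists>w. arr w \<and> src w = tgt q \<and> tgt w = tgt u \<and> w \<cdot> q = u"
    and epi: "\<And>w w'. \<lbrakk>arr w; arr w'; src w = tgt q; src w' = tgt q; tgt w = tgt w'; w \<cdot> q = w' \<cdot> q\<rbrakk> \<Longrightarrow> w = w'"
  shows "conf i q"
proof -
  note t = conf_typ [OF assms(1)] assms(2,3)
  obtain w where w: "arr w" "tgt w = tgt q" "src w = tgt p" "w \<cdot> p = q"
    using conf_cok [OF assms(1-4)] by auto
  obtain v where v: "arr v" "tgt v = tgt p" "src v = tgt q" "v \<cdot> q = p"
    using cok [of p] t conf_zero [OF assms(1)] by auto
  have "v \<cdot> w = one (tgt p)"
    by (rule conf_epi [OF assms(1)]) (use t v w in \<open>simp_all add: cmp_assoc\<close>)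
  moreover have "w \<cdot> v = one (tgt q)"
    by (rule epi) (use t v w in \<open>simp_all add: cmp_assoc\<close>)
  ultimately have inv: "inverses w v"
    using v w by (simp add: inverses_def)
  show ?thesis
    by (rule conf_iso [OF assms(1) inverses_one [of "src i"] inverses_one [of "tgt i"] inv]) (use t w in simp_all)
qed

text \<open>The axiom yields some pushout with an inflation; the given one is isomorphic to it, so
  its \<open>i'\<close> is an inflation too. The deflation is then chosen afresh as the arrow
  induced by \<open>p\<close> and zero, which gives control over its composite with
  \<open>f'\<close>.\<close>

lemma pushout_conf:
  assumes "conf i p" "pushout i f i' f'"
  obtains p' where "conf i' p'" "p' \<cdot> f' = p" "tgt p' = tgt p"
proof -
  note po = pushoutD [OF assms(2)]
  note t = conf_typ [OF assms(1)]
  obtain i2 f2 q where 2: "pushout i f i2 f2" and q: "conf i2 q"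
    using conf_pushout [OF assms(1) po(2,5)] by auto
  note po2 = pushoutD [OF 2]
  obtain h where h: "arr h" "src h = tgt f'" "tgt h = tgt i2" "h \<cdot> f' = f2" "h \<cdot> i' = i2"
    by (rule pushout_factor [OF assms(2) po2(4,3,6,7) po2(8) [symmetric] po2(9)])
  obtain k where k: "arr k" "src k = tgt f2" "tgt k = tgt i'" "k \<cdot> f2 = f'" "k \<cdot> i2 = i'"
    by (rule pushout_factor [OF 2 po(4,3,6,7) po(8) [symmetric] po(9)])
  have "k \<cdot> h = one (tgt f')"
    by (rule pushout_jointly_epi [OF assms(2)]) (use po(1-8) po2(1-8) h k in \<open>simp_all add: cmp_assoc\<close>)
  moreover have hk: "h \<cdot> k = one (tgt f2)"
    by (rule pushout_jointly_epi [OF 2]) (use po(1-8) po2(1-8) h k in \<open>simp_all add: cmp_assoc\<close>)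
  ultimately have inv: "inverses k h"
    using h k po2(8) po(8) by (simp add: inverses_def)
  \<comment> \<open>A provisional deflation, transported along the comparison isomorphism; its only
    use is to certify that \<open>i'\<close> is an inflation.\<close>
  have q': "conf i' (q \<cdot> h)"
    by (rule conf_iso [OF q inverses_one [of "tgt f"] inv inverses_one [of "tgt q"]])
      (use po(1-8) po2(1-8) h k conf_typ [OF q] hk in \<open>simp_all add: cmp_assoc\<close>)
  have "p \<cdot> i = zero (src i') (tgt p) \<cdot> f"
    using t po(1-8) conf_zero [OF assms(1)] by simp
  \<comment> \<open>The required deflation: \<open>p\<close> on one leg of the pushout and zero on
    the other.\<close>
  then obtain r where r: "arr r" "src r = tgt f'" "tgt r = tgt p" "r \<cdot> f' = p" "r \<cdot> i' = zero (src i') (tgt p)"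
    by (rule pushout_factor [OF assms(2), rotated 5]) (use po(1-8) t in simp_all)
  have "conf i' r"
  proof (rule cokernel_conf [OF q'])
    fix u assume u: "arr u" "src u = tgt i'" "u \<cdot> i' = zero (src i') (tgt u)"
    \<comment> \<open>If \<open>u\<close> kills \<open>i'\<close>, then \<open>u \<cdot> f'\<close>
      kills \<open>i\<close> and so factors through \<open>p\<close>; the factor also works for
      \<open>r\<close>, as is seen on the two legs.\<close>
    have "u \<cdot> f' \<cdot> i = u \<cdot> i' \<cdot> f"
      using u(1,2) po by (simp add: cmp_assoc)
    then have "u \<cdot> f' \<cdot> i = zero (src i) (tgt u)"
      using u po(1-8) by simp
    then obtain w where w: "arr w" "src w = tgt p" "tgt w = tgt u" "w \<cdot> p = u \<cdot> f'"
      using conf_cok [OF assms(1), of "u \<cdot> f'"] u(1,2) po(1-8) by auto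
    have "w \<cdot> r = u"
      by (rule pushout_jointly_epi [OF assms(2)]) (use u w r po(1-8) in \<open>simp_all add: cmp_assoc\<close>)
    then show "\<exists>w. arr w \<and> src w = tgt r \<and> tgt w = tgt u \<and> w \<cdot> r = u"
      using w r by auto
  next
    fix w w' assume w: "arr w" "arr w'" "src w = tgt r" "src w' = tgt r" "tgt w = tgt w'" "w \<cdot> r = w' \<cdot> r"
    then have "w \<cdot> r \<cdot> f' = w' \<cdot> r \<cdot> f'" by simp
    then have "w \<cdot> p = w' \<cdot> p" using w(1-5) r po(1-8) by (simp add: cmp_assoc)
    then show "w = w'" using conf_epi [OF assms(1)] w r by metis
  qed (use r po(8) in simp_all)
  then show ?thesis using that r by blast
qed

text \<open>For A inside B inside C, with \<open>f\<close> and \<open>g\<close> the inclusions, the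
  arrow \<open>j\<close> is B/A \<rightarrow> C/A and \<open>r\<close> is C/A \<rightarrow> C/B. The
  square formed by \<open>g\<close>, \<open>p\<close>, \<open>j\<close>, \<open>q\<close> is a
  pushout: an arrow on C whose restriction to B factors through B/A kills A, hence factors through
  C/A. Then \<open>pushout_conf\<close> applies to the inflation \<open>g\<close>.\<close>

lemma noether_conf:
  assumes fp: "conf f p" and gs: "conf g s" and hq: "conf (g \<cdot> f) q" and "src g = tgt f"
  obtains j r where "conf j r" "j \<cdot> p = q \<cdot> g" "r \<cdot> q = s" "src j = tgt p" "tgt j = tgt q"
proof -
  note t = conf_typ [OF fp] conf_typ [OF gs] conf_typ [OF hq] assms(4)
  have "(q \<cdot> g) \<cdot> f = zero (src f) (tgt q)"
    using t conf_zero [OF hq] by (simp add: cmp_assoc)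
  then obtain j where j: "arr j" "tgt j = tgt q" "src j = tgt p" "j \<cdot> p = q \<cdot> g"
    using conf_cok [OF fp, of "q \<cdot> g"] t by auto
  have "pushout g p j q"
    unfolding pushout_square_def
  proof (intro conjI allI impI, goal_cases)
    case (10 u v)
    have "u \<cdot> (g \<cdot> f) = (v \<cdot> p) \<cdot> f" using 10 t by (simp flip: cmp_assoc)
    also have "\<dots> = zero (src (g \<cdot> f)) (tgt u)"
      using 10 t conf_zero [OF fp] by (simp add: cmp_assoc)
    finally obtain w where w: "arr w" "tgt w = tgt u" "src w = tgt q" "w \<cdot> q = u"
      using conf_cok [OF hq, of u] 10 t by auto
    have "w \<cdot> j = v"
    proof (rule conf_epi [OF fp])
      have "w \<cdot> j \<cdot> p = w \<cdot> q \<cdot> g" using w(1-3) j t by (simp add: cmp_assoc)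
      then show "w \<cdot> j \<cdot> p = v \<cdot> p" using w 10 by simp
    qed (use w j 10 t in simp_all)
    then show ?case using w j by auto
  next
    case (11 w w')
    then show ?case using conf_epi [OF hq, of w w'] j by auto
  qed (use t j in simp_all)
  from pushout_conf [OF gs this] obtain r where "conf j r" "r \<cdot> q = s" .
  with j show ?thesis by (intro that)
qed

text \<open>Composing the kernel of an identity with that identity changes nothing and gives zero.
  The result is the inflation out of a zero object from which \<open>conf_graph\<close> obtains
  split inflations as pushouts.\<close>

lemma conf_zero_one:
  assumes "A \<in> Ob"
  obtains z where "conf z (one A)" "arr z" "tgt z = A" "z = zero (src z) A"
proof -
  obtain z where z: "conf z (one A)" using conf_one assms by blast
  have t: "arr z" "tgt z = A" using conf_typ [OF z] assms by simp_all
  have 0: "z = zero (src z) A"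
    using conf_zero [OF z] unfolding cmp_one(2) [OF t(1) t(2) [symmetric]] one_typ(3) [OF assms] .
  show ?thesis by (rule that [OF z t 0])
qed

text \<open>Shearing a biproduct leaves it a coproduct: the graph of \<open>f\<close> together with
  \<open>j\<close> again presents the sum. A coproduct is a pushout over a zero object, so the graph
  is a pushout of the inflation \<open>z\<close>.\<close>

lemma conf_graph:
  assumes "biprod i j p q" "arr f" "src f = src i" "tgt f = src j"
  obtains r where "conf (i \<boxplus> j \<cdot> f) r"
proof -
  note b = biprodD [OF assms(1)]
  obtain z where z: "conf z (one (src j))" "arr z" "tgt z = src j"
    "z = zero (src z) (src j)"
    by (rule conf_zero_one [of "src j"]) (use b in simp_all)
  have po: "pushout z (zero (src z) (src i)) (i \<boxplus> j \<cdot> f) j"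
    unfolding pushout_square_def
  proof (intro conjI allI impI, goal_cases)
    case 9
    then show ?case using b z(1-3) assms(2-) by (subst z(4)) simp
  next
    case (10 u v)
    then have uv: "arr u" "arr v" "src u = src j" "src v = src i" "tgt u = tgt v"
      using b(1-9) z(2,3) by auto
    \<comment> \<open>On the first summand the value is \<open>v\<close> corrected by
      \<open>u \<cdot> f\<close>, which cancels the contribution of the second summand along the
      graph.\<close>
    let ?w = "(v \<boxplus> neg (u \<cdot> f)) \<cdot> p \<boxplus> u \<cdot> q"
    have "?w \<cdot> j = u" "?w \<cdot> (i \<boxplus> j \<cdot> f) = v"
      using uv b(1-13) assms(2-)
      by (simp_all add: cmp_assoc cmp_add_left cmp_add_right biprod_cmp [OF assms(1)] add_assoc)
    then show ?case using uv b(1-9) assms(2-) by (intro exI [of _ ?w]) simp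
  next
    case (11 w w')
    then have w: "arr w" "arr w'" "src w = tgt i" "src w' = tgt i" "tgt w = tgt w'"
      and eq: "w \<cdot> j = w' \<cdot> j" "w \<cdot> (i \<boxplus> j \<cdot> f) = w' \<cdot> (i \<boxplus> j \<cdot> f)"
      using b(1-9) assms(2-) by auto
    have expand: "x \<cdot> (i \<boxplus> j \<cdot> f) = x \<cdot> i \<boxplus> x \<cdot> j \<cdot> f" if "arr x" "src x = tgt i" for x
      using that b(1-9) assms(2-) by (simp add: cmp_assoc cmp_add_left)
    have "w \<cdot> i \<boxplus> w \<cdot> j \<cdot> f = w' \<cdot> i \<boxplus> w \<cdot> j \<cdot> f"
      using eq(2) by (simp only: expand [OF w(1,3)] expand [OF w(2,4)] eq(1))
    then have "w \<cdot> i = w' \<cdot> i"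
      by (rule add_cancel [rotated 7]) (use w b(1-9) assms(2-) in simp_all)
    then show ?case by (rule biprod_jointly_epi [OF assms(1) w(1-4)]) (rule eq(1))
  qed (use b assms(2-) z(1-3) in simp_all)
  show ?thesis by (rule pushout_conf [OF z(1) po]) (rule that)
qed

text \<open>The sum of \<open>f\<close> with the identity of the second summand is the pushout of
  \<open>f\<close> along the injection \<open>i\<close> of the first summand.\<close>

lemma conf_biprod_one:
  assumes "conf f r" "biprod i j p q" "biprod i' j' p' q'" "src i = src f" "src i' = tgt f" "src j' = src j"
  obtains s where "conf (i' \<cdot> f \<cdot> p \<boxplus> j' \<cdot> q) s"
proof -
  note b = biprodD [OF assms(2)]
  note b' = biprodD [OF assms(3)]
  note t = conf_typ [OF assms(1)] assms(4-)
  have po: "pushout f i (i' \<cdot> f \<cdot> p \<boxplus> j' \<cdot> q) i'"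
    unfolding pushout_square_def
  proof (intro conjI allI impI, goal_cases)
    case 9
    then show ?case using b b' t by (simp add: cmp_assoc cmp_add_right)
  next
    case (10 u v)
    then have uv: "arr u" "arr v" "src u = tgt f" "src v = tgt i" "tgt u = tgt v" and eq: "u \<cdot> f = v \<cdot> i"
      by auto
    \<comment> \<open>The first component is prescribed by \<open>u\<close>; on the second summand
      the sum arrow is the identity, so that component must be the one of \<open>v\<close>.\<close>
    let ?w = "u \<cdot> p' \<boxplus> v \<cdot> j \<cdot> q'"
    have "?w \<cdot> i' = u"
      using uv b b' t by (simp add: cmp_assoc cmp_add_right)
    moreover have "?w \<cdot> (i' \<cdot> f \<cdot> p \<boxplus> j' \<cdot> q) = u \<cdot> f \<cdot> p \<boxplus> v \<cdot> j \<cdot> q"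
      using uv b b' t
      by (simp add: cmp_assoc cmp_add_left cmp_add_right biprod_cmp [OF assms(3)])
    then have "?w \<cdot> (i' \<cdot> f \<cdot> p \<boxplus> j' \<cdot> q) = v"
      using eq uv biprod_decompose [OF assms(2), of v] by simp
    ultimately show ?case using uv b b' t by (intro exI [of _ ?w]) simp
  next
    case (11 w w')
    then have w: "arr w" "arr w'" "src w = tgt i'" "src w' = tgt i'" "tgt w = tgt w'" "w \<cdot> i' = w' \<cdot> i'"
      and eq: "w \<cdot> (i' \<cdot> f \<cdot> p \<boxplus> j' \<cdot> q) \<cdot> j = w' \<cdot> (i' \<cdot> f \<cdot> p \<boxplus> j' \<cdot> q) \<cdot> j"
      using b b' t by auto
    then have "w \<cdot> j' = w' \<cdot> j'"
      using w(1-5) b b' t by (simp add: cmp_assoc cmp_add_left cmp_add_right)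
    then show ?case by (rule biprod_jointly_epi [OF assms(3), rotated 5]) (use w b b' t in simp_all)
  qed (use b b' t in simp_all)
  show ?thesis by (rule pushout_conf [OF assms(1) po]) (rule that)
qed

text \<open>The arrow with components \<open>i\<close> and \<open>f\<close> is an inflation because
  it is the graph of \<open>f\<close> followed by the sum of \<open>i\<close> with an identity. The
  pushout property says precisely that the difference of \<open>f'\<close> and \<open>i'\<close> is
  its cokernel; the minus sign turns the commuting square into a zero composite.\<close>

lemma pushout_conf_biprod:
  assumes "conf i r" "pushout i f i' f'" "biprod j k p q" "src j = tgt i" "src k = tgt f"
  shows "conf (j \<cdot> i \<boxplus> k \<cdot> f) (f' \<cdot> p \<boxplus> neg (i' \<cdot> q))"
proof -
  note b = biprodD [OF assms(3)]
  note po' = pushoutD [OF assms(2)]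
  note po = po'(1-8)
  note t = conf_typ [OF assms(1)] assms(4-)
  obtain j1 k1 p1 q1 where 1: "biprod j1 k1 p1 q1" "src j1 = src i" "src k1 = tgt f"
    using biprod_exists po t by (metis ends)
  note b1 = biprodD [OF 1(1)]
  obtain x where x: "conf (j1 \<boxplus> k1 \<cdot> f) x"
    using conf_graph [OF 1(1), of f] po 1 by auto
  obtain y where y: "conf (j \<cdot> i \<cdot> p1 \<boxplus> k \<cdot> q1) y"
    using conf_biprod_one [OF assms(1) 1(1) assms(3)] t 1 by auto
  have "(j \<cdot> i \<cdot> p1 \<boxplus> k \<cdot> q1) \<cdot> (j1 \<boxplus> k1 \<cdot> f) = j \<cdot> i \<boxplus> k \<cdot> f"
    using b b1 t po 1 by (simp add: cmp_assoc cmp_add_left cmp_add_right biprod_cmp [OF 1(1)])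
  with conf_mono_cmp [OF x y] obtain s where s: "conf (j \<cdot> i \<boxplus> k \<cdot> f) s"
    using b b1 po t 1 by auto
  show ?thesis
  proof (rule cokernel_conf [OF s])
    show "(f' \<cdot> p \<boxplus> neg (i' \<cdot> q)) \<cdot> (j \<cdot> i \<boxplus> k \<cdot> f) =
      zero (src (j \<cdot> i \<boxplus> k \<cdot> f)) (tgt (f' \<cdot> p \<boxplus> neg (i' \<cdot> q)))"
      using b t po po'(9) by (simp add: cmp_assoc cmp_add_left cmp_add_right biprod_cmp [OF assms(3)])
  next
    fix u
    assume "arr u" and "src u = tgt (j \<cdot> i \<boxplus> k \<cdot> f)"
      and 0: "u \<cdot> (j \<cdot> i \<boxplus> k \<cdot> f) = zero (src (j \<cdot> i \<boxplus> k \<cdot> f)) (tgt u)"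
    then have u: "arr u" "src u = tgt j" using b t po by simp_all
    \<comment> \<open>Killing the inflation means that the components of \<open>u\<close>, the
      second one negated, form a cocone on the pushout square.\<close>
    have "neg (u \<cdot> k \<cdot> f) = u \<cdot> j \<cdot> i"
      using 0 b t po u by (intro neg_unique [symmetric]) (simp_all add: cmp_assoc cmp_add_left add_comm [of "u \<cdot> (k \<cdot> f)"])
    then have "(u \<cdot> j) \<cdot> i = neg (u \<cdot> k) \<cdot> f"
      using b t po u by simp
    then obtain w where w: "arr w" "src w = tgt f'" "tgt w = tgt u" "w \<cdot> f' = u \<cdot> j" "w \<cdot> i' = neg (u \<cdot> k)"
      by (rule pushout_factor [OF assms(2), rotated 5]) (use b t po u in simp_all)
    have "w \<cdot> (f' \<cdot> p \<boxplus> neg (i' \<cdot> q)) = w \<cdot> f' \<cdot> p \<boxplus> neg (w \<cdot> i' \<cdot> q)"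
      using b t po u w(1-3) by (simp add: cmp_assoc cmp_add_left)
    also have "\<dots> = u"
      using b t po u biprod_decompose [OF assms(3), of u] by (simp add: w(4,5))
    finally show "\<exists>w. arr w \<and> src w = tgt (f' \<cdot> p \<boxplus> neg (i' \<cdot> q)) \<and> tgt w = tgt u \<and> w \<cdot> (f' \<cdot> p \<boxplus> neg (i' \<cdot> q)) = u"
      using b t po w by (intro exI [of _ w]) simp
  next
    fix w w' assume "arr w" "arr w'" "src w = tgt (f' \<cdot> p \<boxplus> neg (i' \<cdot> q))"
      "src w' = tgt (f' \<cdot> p \<boxplus> neg (i' \<cdot> q))" "tgt w = tgt w'"
      and eq: "w \<cdot> (f' \<cdot> p \<boxplus> neg (i' \<cdot> q)) = w' \<cdot> (f' \<cdot> p \<boxplus> neg (i' \<cdot> q))"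
    then have w: "arr w" "arr w'" "src w = tgt i'" "src w' = tgt i'" "tgt w = tgt w'"
      using b t po by simp_all
    \<comment> \<open>Restricting to the two summands recovers the composites with both legs of the
      pushout.\<close>
    from eq have "w \<cdot> (f' \<cdot> p \<boxplus> neg (i' \<cdot> q)) \<cdot> j = w' \<cdot> (f' \<cdot> p \<boxplus> neg (i' \<cdot> q)) \<cdot> j"
      "w \<cdot> (f' \<cdot> p \<boxplus> neg (i' \<cdot> q)) \<cdot> k = w' \<cdot> (f' \<cdot> p \<boxplus> neg (i' \<cdot> q)) \<cdot> k"
      by simp_all
    then have "w \<cdot> f' = w' \<cdot> f'" "neg (w \<cdot> i') = neg (w' \<cdot> i')"
      using w b t po by (simp_all add: cmp_assoc cmp_add_left cmp_add_right)
    moreover have "w \<cdot> i' = w' \<cdot> i'"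
      using calculation(2) w po by (metis neg_neg cmp_typ(1))
    with calculation(1) show "w = w'"
      by (intro pushout_jointly_epi [OF assms(2), of w w']) (use w po in simp_all)
  qed (use b t po in simp_all)
qed

section \<open>Dual statements, read off in the opposite category\<close>

lemma op: "exact_cat Ob arr tgt src (\<lambda>g f. f \<cdot> g) one (\<lambda>A B. zero B A) add neg (\<lambda>p i. conf i p)"
  by (rule exact_cat_dual) unfold_locales

lemma pullback_conf:
  assumes "conf i p" "pullback p f p' f'"
  obtains i' where "conf i' p'" "f' \<cdot> i' = i" "src i' = src i"
  using exact_cat.pushout_conf [OF op assms] by metis

lemma noether_conf_dual:
  assumes "conf i f" "conf j g" "conf k (g \<cdot> f)" "src g = tgt f"
  obtains l m where "conf l m" "j \<cdot> m = f \<cdot> k" "k \<cdot> l = i" "tgt m = src j" "src m = src k"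
  using exact_cat.noether_conf [OF op assms(2,1,3) assms(4) [symmetric]] by metis

lemma pullback_conf_biprod:
  assumes "conf r p" "pullback p f p' f'" "biprod a b j k" "tgt j = src p" "tgt k = src f"
  shows "conf (a \<cdot> f' \<boxplus> neg (b \<cdot> p')) (p \<cdot> j \<boxplus> f \<cdot> k)"
proof -
  interpret op: exact_cat Ob arr tgt src "\<lambda>g f. f \<cdot> g" one "\<lambda>A B. zero B A" add neg "\<lambda>p i. conf i p"
    by (rule op)
  have "op.biprod j k a b"
    using biprodD [OF assms(3)] by (simp add: op.biprod_def)
  from op.pushout_conf_biprod [OF assms(1,2) this assms(4,5)] show ?thesis .
qed

end

text \<open>Kernel and cokernel properties and the existence of pushouts and pullbacks come from the
  ambient structure; what remains is membership of the relevant arrows. Accordingly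
  \<open>sub_pushout\<close> and \<open>sub_pullback\<close> speak of every ambient square, and
  \<open>sub_iso\<close> starts from a sequence already known to be a conflation.\<close>

locale exact_substructure = exact_cat +
  fixes conf' :: "'b \<Rightarrow> 'b \<Rightarrow> bool"
  assumes sub_conf: "conf' i p \<Longrightarrow> conf i p"
    and sub_iso: "\<lbrakk>conf' i p; conf i' p'; inverses a a'; inverses b b'; inverses c c';
      src i' = tgt a; tgt i' = tgt b; src p' = tgt b; tgt p' = tgt c; src a = src i; src b = src p; src c = tgt p;
      b \<cdot> i = i' \<cdot> a; c \<cdot> p = p' \<cdot> b\<rbrakk> \<Longrightarrow> conf' i' p'"
    and sub_one: "A \<in> Ob \<Longrightarrow> \<exists>p. conf' (one A) p" "A \<in> Ob \<Longrightarrow> \<exists>i. conf' i (one A)"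
    and sub_mono_cmp: "\<lbrakk>conf' f p; conf' g q; src g = tgt f\<rbrakk> \<Longrightarrow> \<exists>r. conf' (g \<cdot> f) r"
    and sub_epi_cmp: "\<lbrakk>conf' i f; conf' j g; src g = tgt f\<rbrakk> \<Longrightarrow> \<exists>k. conf' k (g \<cdot> f)"
    and sub_pushout: "\<lbrakk>conf' i p; pushout i f i' f'\<rbrakk> \<Longrightarrow> \<exists>p'. conf' i' p'"
    and sub_pullback: "\<lbrakk>conf' i p; pullback p f p' f'\<rbrakk> \<Longrightarrow> \<exists>i'. conf' i' p'"

text \<open>For a contravariant functor the substructure is found in the opposite category; this
  brings it back.\<close>

lemma exact_substructure_dual:
  assumes "exact_substructure Ob arr src tgt cmp uno nul pls neg conf conf'"
  shows "exact_substructure Ob arr tgt src (\<lambda>g f. cmp f g) uno (\<lambda>A B. nul B A) pls neg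
    (\<lambda>p i. conf i p) (\<lambda>p i. conf' i p)"
proof -
  interpret exact_substructure Ob arr src tgt cmp uno nul pls neg conf conf' by (rule assms)
  interpret op: exact_cat Ob arr tgt src "\<lambda>g f. cmp f g" uno "\<lambda>A B. nul B A" pls neg "\<lambda>p i. conf i p"
    by (rule op)
  have inverses: "op.inverses a a' \<longleftrightarrow> inverses a' a" for a a'
    by (auto simp: op.inverses_def inverses_def)
  have inverses_commute: "inverses a a' \<longleftrightarrow> inverses a' a" for a a'
    by (auto simp: inverses_def)
  show ?thesis
  proof (unfold_locales, goal_cases)
    case 1
    then show ?case by (rule sub_conf)
  next
    case (2 i p i' p' a a' b b' c c')
    have inv: "inverses a' a" "inverses b' b" "inverses c' c"
      using 2(3-5) by (simp_all add: inverses)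
    note inv' = inv [THEN inverses_commute [THEN iffD1]]
    have ti: "arr a" "arr b" "arr c" "arr a'" "arr b'" "arr c'" "src a = tgt a'" "src b = tgt b'" "src c = tgt c'"
      "tgt a = src a'" "tgt b = src b'" "tgt c = src c'"
      using inv by (simp_all add: inverses_def)
    note ty = 2(6-12) ti conf_typ [OF sub_conf [OF 2(1)]] conf_typ [OF 2(2)]
    have "cmp b' p = cmp p' c'"
      by (rule inverses_square [OF inv'(3,2)]) (use ty 2(14) in simp_all)
    moreover have "cmp a' i = cmp i' b'"
      by (rule inverses_square [OF inv'(2,1)]) (use ty 2(13) in simp_all)
    ultimately show ?case
      by (intro sub_iso [OF 2(1,2) inv(3,2,1)]) (use ty in simp_all)
  next
    case 3
    then show ?case by (rule sub_one)
  next
    case 4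
    then show ?case by (rule sub_one)
  next
    case 5
    then show ?case by (metis sub_epi_cmp)
  next
    case 6
    then show ?case by (metis sub_mono_cmp)
  next
    case 7
    then show ?case by (rule sub_pullback)
  next
    case 8
    then show ?case by (rule sub_pushout)
  qed
qed

section \<open>Half-exact functors on an exact category\<close>

text \<open>Values are seen as abelian groups and arrows act on elements, the form in which the
  diagram chases use them. The last axiom is exactness at the middle term.\<close>

locale half_exact_functor = exact_cat +
  fixes Go :: "'a \<Rightarrow> ('r, 'n) module" and Gm :: "'b \<Rightarrow> 'n \<Rightarrow> 'n"
  assumes Go_group: "A \<in> Ob \<Longrightarrow> abelian_group (Go A)"
    and Gm_closed: "arr f \<Longrightarrow> x \<in> carrier (Go (src f)) \<Longrightarrow> Gm f x \<in> carrier (Go (tgt f))"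
    and Gm_hom: "arr f \<Longrightarrow> x \<in> carrier (Go (src f)) \<Longrightarrow> y \<in> carrier (Go (src f)) \<Longrightarrow>
      Gm f (x \<oplus>\<^bsub>Go (src f)\<^esub> y) = Gm f x \<oplus>\<^bsub>Go (tgt f)\<^esub> Gm f y"
    and Gm_one: "x \<in> carrier (Go A) \<Longrightarrow> A \<in> Ob \<Longrightarrow> Gm (one A) x = x"
    and Gm_cmp: "arr f \<Longrightarrow> arr g \<Longrightarrow> src g = tgt f \<Longrightarrow> x \<in> carrier (Go (src f)) \<Longrightarrow>
      Gm (g \<cdot> f) x = Gm g (Gm f x)"
    and Gm_add: "arr f \<Longrightarrow> arr g \<Longrightarrow> src f = src g \<Longrightarrow> tgt f = tgt g \<Longrightarrow> x \<in> carrier (Go (src g)) \<Longrightarrow>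
      Gm (f \<boxplus> g) x = Gm f x \<oplus>\<^bsub>Go (tgt g)\<^esub> Gm g x"
    and Gm_exact: "conf i p \<Longrightarrow> Gm i ` carrier (Go (src i)) = {x \<in> carrier (Go (src p)). Gm p x = \<zero>\<^bsub>Go (tgt p)\<^esub>}"
begin

section \<open>The functor on elements\<close>

abbreviation el :: "'a \<Rightarrow> 'n set" where "el A \<equiv> carrier (Go A)"

lemma Gm_null [simp]:
  assumes "arr f" "A = src f"
  shows "Gm f \<zero>\<^bsub>Go A\<^esub> = \<zero>\<^bsub>Go (tgt f)\<^esub>"
proof -
  interpret S: abelian_group "Go (src f)" using assms Go_group by simp
  interpret T: abelian_group "Go (tgt f)" using assms Go_group by simp
  show ?thesis
    using Gm_hom [OF assms(1) S.zero_closed S.zero_closed] Gm_closed [OF assms(1) S.zero_closed] assms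
    by simp
qed

lemma Gm_minus:
  assumes "arr f" "x \<in> el (src f)"
  shows "Gm f (\<ominus>\<^bsub>Go (src f)\<^esub> x) = \<ominus>\<^bsub>Go (tgt f)\<^esub> Gm f x"
proof -
  interpret S: abelian_group "Go (src f)" using assms Go_group by simp
  interpret T: abelian_group "Go (tgt f)" using assms Go_group by simp
  have "Gm f (\<ominus>\<^bsub>Go (src f)\<^esub> x) \<oplus>\<^bsub>Go (tgt f)\<^esub> Gm f x = \<zero>\<^bsub>Go (tgt f)\<^esub>"
    using assms by (simp add: S.l_neg flip: Gm_hom)
  then show ?thesis
    using assms by (simp add: T.minus_equality Gm_closed)
qed

text \<open>A zero arrow is its own double, so by additivity of the functor the image of
  \<open>x\<close> equals its own double.\<close>

lemma Gm_zero [simp]: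
  assumes "A \<in> Ob" "B \<in> Ob" "x \<in> el A"
  shows "Gm (zero A B) x = \<zero>\<^bsub>Go B\<^esub>"
proof -
  interpret T: abelian_group "Go B" using assms Go_group by simp
  have "Gm (zero A B) x \<in> el B"
    using Gm_closed [of "zero A B" x] assms by simp
  then show ?thesis
    using Gm_add [of "zero A B" "zero A B" x] assms by simp
qed

lemma Gm_neg:
  assumes "arr f" "x \<in> el (src f)"
  shows "Gm (neg f) x = \<ominus>\<^bsub>Go (tgt f)\<^esub> Gm f x"
proof -
  interpret T: abelian_group "Go (tgt f)" using assms Go_group by simp
  have "Gm (neg f) x \<oplus>\<^bsub>Go (tgt f)\<^esub> Gm f x = \<zero>\<^bsub>Go (tgt f)\<^esub>"
    using assms Gm_add [of "neg f" f x] by simp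
  then show ?thesis
    using assms Gm_closed [of f x] Gm_closed [of "neg f" x] by (simp add: T.minus_equality)
qed

lemma Gm_inverses:
  assumes "inverses a a'"
  shows "x \<in> el (src a) \<Longrightarrow> Gm a' (Gm a x) = x" "x \<in> el (tgt a) \<Longrightarrow> Gm a (Gm a' x) = x"
  using assms Gm_cmp [of a a' x] Gm_cmp [of a' a x] by (auto simp: inverses_def Gm_one)

lemma Gm_conf_lift:
  assumes "conf i p" "y \<in> el (src p)" "Gm p y = \<zero>\<^bsub>Go (tgt p)\<^esub>"
  obtains x where "x \<in> el (src i)" "Gm i x = y"
proof -
  have "y \<in> Gm i ` el (src i)"
    using assms(2,3) by (simp add: Gm_exact [OF assms(1)])
  then show ?thesis using that by blast
qed

section \<open>Closure properties of the conflations with short exact image\<close>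

definition gexact :: "'b \<Rightarrow> 'b \<Rightarrow> bool" where
  "gexact i p \<longleftrightarrow> conf i p \<and> inj_on (Gm i) (el (src i)) \<and> Gm p ` el (src p) = el (tgt p)"

lemma gexactD:
  assumes "gexact i p"
  shows "conf i p" "x \<in> el (src i) \<Longrightarrow> Gm i x = \<zero>\<^bsub>Go (tgt i)\<^esub> \<Longrightarrow> x = \<zero>\<^bsub>Go (src i)\<^esub>"
proof -
  show c: "conf i p" using assms by (simp add: gexact_def)
  note t = conf_typ [OF c]
  interpret S: abelian_group "Go (src i)" using t Go_group by simp
  show "x = \<zero>\<^bsub>Go (src i)\<^esub>" if "x \<in> el (src i)" "Gm i x = \<zero>\<^bsub>Go (tgt i)\<^esub>"
    using assms that t unfolding gexact_def inj_on_def by force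
qed

lemma gexact_lift:
  assumes "gexact i p" "y \<in> el (tgt p)"
  obtains x where "x \<in> el (src p)" "Gm p x = y"
  using assms by (force simp: gexact_def)

lemma gexactI:
  assumes c: "conf i p"
    and inj: "\<And>x. x \<in> el (src i) \<Longrightarrow> Gm i x = \<zero>\<^bsub>Go (tgt i)\<^esub> \<Longrightarrow> x = \<zero>\<^bsub>Go (src i)\<^esub>"
    and surj: "\<And>y. y \<in> el (tgt p) \<Longrightarrow> \<exists>x \<in> el (src p). Gm p x = y"
  shows "gexact i p"
  unfolding gexact_def
proof (intro conjI c)
  note t = conf_typ [OF c]
  interpret S: abelian_group "Go (src i)" using t Go_group by simp
  interpret T: abelian_group "Go (tgt i)" using t Go_group by simp
  show "inj_on (Gm i) (el (src i))"
  proof (rule inj_onI)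
    fix x y assume xy: "x \<in> el (src i)" "y \<in> el (src i)" "Gm i x = Gm i y"
    then have "Gm i (x \<ominus>\<^bsub>Go (src i)\<^esub> y) = \<zero>\<^bsub>Go (tgt i)\<^esub>"
      using t by (simp add: a_minus_def Gm_hom Gm_minus Gm_closed T.r_neg)
    then have "x \<ominus>\<^bsub>Go (src i)\<^esub> y = \<zero>\<^bsub>Go (src i)\<^esub>"
      using xy by (intro inj) simp_all
    then show "x = y"
      using xy S.minus_equality [of x "\<ominus>\<^bsub>Go (src i)\<^esub> y"] by (simp add: a_minus_def)
  qed
  show "Gm p ` el (src p) = el (tgt p)"
    using surj Gm_closed t by (fastforce simp: image_iff)
qed

lemma gexact_iso:
  assumes g: "gexact i p" and c: "conf i' p'"
    and inv: "inverses a a'" "inverses b b'" "inverses c c'"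
    and ends: "src i' = tgt a" "tgt i' = tgt b" "src p' = tgt b" "tgt p' = tgt c"
      "src a = src i" "src b = src p" "src c = tgt p"
    and sq: "b \<cdot> i = i' \<cdot> a" "c \<cdot> p = p' \<cdot> b"
  shows "gexact i' p'"
proof (rule gexactI [OF c])
  note t = conf_typ [OF c] conf_typ [OF gexactD(1) [OF g]] ends
  have i: "arr a" "arr a'" "src a' = tgt a" "tgt a' = src a"
    "arr b" "arr b'" "src b' = tgt b" "tgt b' = src b"
    "arr c" "arr c'" "src c' = tgt c" "tgt c' = src c"
    using inv by (simp_all add: inverses_def)
  fix x assume x: "x \<in> el (src i')" "Gm i' x = \<zero>\<^bsub>Go (tgt i')\<^esub>"
  have x': "Gm a' x \<in> el (src i)" using Gm_closed [of a' x] t i x by simp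
  have "Gm b (Gm i (Gm a' x)) = Gm (i' \<cdot> a) (Gm a' x)"
    unfolding sq(1) [symmetric] using t i x' by (subst Gm_cmp) simp_all
  also have "\<dots> = Gm i' (Gm a (Gm a' x))"
    using t i x' by (subst Gm_cmp) simp_all
  also have "\<dots> = \<zero>\<^bsub>Go (tgt i')\<^esub>"
    using Gm_inverses(2) [OF inv(1)] t x by simp
  finally have "Gm b' (Gm b (Gm i (Gm a' x))) = \<zero>\<^bsub>Go (tgt b')\<^esub>"
    using i t by simp
  then have "Gm i (Gm a' x) = \<zero>\<^bsub>Go (tgt i)\<^esub>"
    using Gm_inverses(1) [OF inv(2)] Gm_closed [OF t(4) x'] t i by simp
  then have "Gm a' x = \<zero>\<^bsub>Go (src i)\<^esub>"
    using gexactD(2) [OF g x'] by simp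
  then have "Gm a (Gm a' x) = \<zero>\<^bsub>Go (tgt a)\<^esub>"
    using i t by simp
  then show "x = \<zero>\<^bsub>Go (src i')\<^esub>"
    using Gm_inverses(2) [OF inv(1)] t x by simp
next
  note t = conf_typ [OF c] conf_typ [OF gexactD(1) [OF g]] ends
  have i: "arr b" "arr c" "arr c'" "src c' = tgt c" "tgt c' = src c"
    using inv by (simp_all add: inverses_def)
  fix y assume y: "y \<in> el (tgt p')"
  have "Gm c' y \<in> el (tgt p)" using Gm_closed [of c' y] t i y by simp
  then obtain z where z: "z \<in> el (src p)" "Gm p z = Gm c' y" by (rule gexact_lift [OF g])
  have "y = Gm c (Gm p z)"
    using Gm_inverses(2) [OF inv(3)] t y z by simp
  also have "\<dots> = Gm (p' \<cdot> b) z"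
    unfolding sq(2) [symmetric] using t i z by (subst Gm_cmp) simp_all
  also have "\<dots> = Gm p' (Gm b z)"
    using t i z by (subst Gm_cmp) simp_all
  finally show "\<exists>x \<in> el (src p'). Gm p' x = y"
    using Gm_closed [of b z] t i z by auto
qed

text \<open>An additive functor kills zero objects: on the value at \<open>A\<close> the identity
  and the zero map coincide.\<close>

lemma Go_trivial:
  assumes "A \<in> Ob" "one A = zero A A" "x \<in> el A"
  shows "x = \<zero>\<^bsub>Go A\<^esub>"
  using Gm_one [OF assms(3,1)] assms by simp

text \<open>The cokernel and the kernel of an identity are zero objects, so their values are
  trivial; this settles surjectivity in the first case and injectivity in the second.\<close>

lemma gexact_one:
  assumes "A \<in> Ob"
  shows "\<exists>p. gexact (one A) p" "\<exists>i. gexact i (one A)"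
proof -
  obtain p where p: "conf (one A) p" using conf_one assms by blast
  note t = conf_typ [OF p]
  interpret A: abelian_group "Go (src p)" using t Go_group by simp
  have src_p: "src p = A" using t assms by simp
  have "p = zero A (tgt p)"
    using conf_zero [OF p] cmp_one(1) [OF t(2), of A] src_p one_typ(2) [OF assms] by simp
  \<comment> \<open>The identity and the zero arrow of the quotient agree after \<open>p\<close> and
    may be cancelled, so the quotient is a zero object.\<close>
  then have "one (tgt p) \<cdot> p = zero (tgt p) (tgt p) \<cdot> p"
    using t src_p by simp
  then have "one (tgt p) = zero (tgt p) (tgt p)"
    by (rule conf_epi [OF p, rotated 5]) (use t in simp_all)
  then have "y = \<zero>\<^bsub>Go (tgt p)\<^esub>" if "y \<in> el (tgt p)" for y
    using Go_trivial [of "tgt p" y] t that by simp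
  then have "gexact (one A) p"
    by (intro gexactI [OF p]) (use assms t src_p in \<open>auto simp: Gm_one intro!: bexI [of _ "\<zero>\<^bsub>Go A\<^esub>"]\<close>)
  then show "\<exists>p. gexact (one A) p" ..
next
  obtain i where i: "conf i (one A)" using conf_one assms by blast
  note t = conf_typ [OF i]
  have tgt_i: "tgt i = A" using t assms by simp
  have "i = zero (src i) A"
    using conf_zero [OF i] cmp_one(2) [OF t(1), of A] tgt_i one_typ(3) [OF assms] by simp
  then have "i \<cdot> one (src i) = i \<cdot> zero (src i) (src i)"
    using t tgt_i by simp
  then have "one (src i) = zero (src i) (src i)"
    by (rule conf_mono [OF i, rotated 5]) (use t in simp_all)
  then have "gexact i (one A)"
    by (intro gexactI [OF i]) (use Go_trivial [of "src i"] assms t in \<open>auto simp: Gm_one\<close>)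
  then show "\<exists>i. gexact i (one A)" ..
qed

text \<open>Injective maps compose. Surjectivity onto the value at C/A is a five lemma chase on B/A
  \<rightarrow> C/A \<rightarrow> C/B: the maps from the values at B and C to those at B/A and C/B
  are onto.\<close>

lemma gexact_mono_cmp:
  assumes f: "gexact f p" and g: "gexact g q" and fg: "src g = tgt f"
  shows "\<exists>r. gexact (g \<cdot> f) r"
proof -
  note cf = gexactD(1) [OF f] and cg = gexactD(1) [OF g]
  obtain h where h: "conf (g \<cdot> f) h" using conf_mono_cmp [OF cf cg fg] by blast
  obtain j r where j: "conf j r" "j \<cdot> p = h \<cdot> g" "r \<cdot> h = q" "src j = tgt p" "tgt j = tgt h"
    by (rule noether_conf [OF cf cg h fg])
  note t = conf_typ [OF cf] conf_typ [OF cg] conf_typ [OF h] conf_typ [OF j(1)] fg j(4,5)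
  have tr: "tgt r = tgt q" using t by (simp flip: j(3))
  interpret H: abelian_group "Go (tgt h)" using t Go_group by simp
  interpret R: abelian_group "Go (tgt q)" using t Go_group by simp
  have "gexact (g \<cdot> f) h"
  proof (rule gexactI [OF h])
    fix x assume "x \<in> el (src (g \<cdot> f))" "Gm (g \<cdot> f) x = \<zero>\<^bsub>Go (tgt (g \<cdot> f))\<^esub>"
    then have x: "x \<in> el (src f)" "Gm g (Gm f x) = \<zero>\<^bsub>Go (tgt g)\<^esub>"
      using t by (simp_all add: Gm_cmp)
    have "Gm f x = \<zero>\<^bsub>Go (src g)\<^esub>"
      by (rule gexactD(2) [OF g]) (use x t Gm_closed [of f x] in simp_all)
    then show "x = \<zero>\<^bsub>Go (src (g \<cdot> f))\<^esub>"
      using gexactD(2) [OF f] x t by simp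
  next
    fix y assume y: "y \<in> el (tgt h)"
    have "Gm r y \<in> el (tgt q)" using Gm_closed [of r y] t y tr by simp
    \<comment> \<open>A first approximation to a preimage of \<open>y\<close>, correct only after
      applying \<open>r\<close>.\<close>
    then obtain c where c: "c \<in> el (src q)" "Gm q c = Gm r y" by (rule gexact_lift [OF g])
    interpret C: abelian_group "Go (src q)" using t Go_group by simp
    have hc: "Gm h c \<in> el (tgt h)" using Gm_closed [of h c] t c by simp
    have "Gm r (Gm h c) = Gm r y"
      using c t Gm_cmp [of h r c] by (simp add: j(3))
    then have "Gm r (y \<ominus>\<^bsub>Go (tgt h)\<^esub> Gm h c) = \<zero>\<^bsub>Go (tgt r)\<^esub>"
      using t y hc Gm_closed [of r y] tr Gm_hom [of r y "\<ominus>\<^bsub>Go (tgt h)\<^esub> Gm h c"] Gm_minus [of r "Gm h c"]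
      by (simp add: a_minus_def R.r_neg)
    \<comment> \<open>The error is killed by \<open>r\<close>, hence comes from the value at B/A;
      lifting it on to B yields the correction \<open>Gm g b\<close> of \<open>c\<close>.\<close>
    then obtain d where d: "d \<in> el (src j)" "Gm j d = y \<ominus>\<^bsub>Go (tgt h)\<^esub> Gm h c"
      by (rule Gm_conf_lift [OF j(1), rotated]) (use t y hc in simp_all)
    obtain b where b: "b \<in> el (src p)" "Gm p b = d"
      by (rule gexact_lift [OF f, of d]) (use d t in simp_all)
    have gb: "Gm g b \<in> el (src q)" using Gm_closed [of g b] b t by simp
    have "Gm h (Gm g b) = Gm (j \<cdot> p) b"
      unfolding j(2) using b t by (subst Gm_cmp) simp_all
    also have "\<dots> = y \<ominus>\<^bsub>Go (tgt h)\<^esub> Gm h c"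
      using b d t by (subst Gm_cmp) simp_all
    finally have "Gm h (c \<oplus>\<^bsub>Go (src q)\<^esub> Gm g b) = Gm h c \<oplus>\<^bsub>Go (tgt h)\<^esub> (y \<ominus>\<^bsub>Go (tgt h)\<^esub> Gm h c)"
      using Gm_hom [of h c "Gm g b"] c gb t by simp
    also have "\<dots> = y"
      using y hc by (simp add: a_minus_def H.a_ac(3) H.r_neg)
    finally show "\<exists>x \<in> el (src h). Gm h x = y"
      using C.a_closed [OF c(1) gb] t by auto
  qed
  then show ?thesis ..
qed

text \<open>Surjective maps compose. For injectivity an element \<open>x\<close> killed by
  \<open>k\<close> is tested in the conflation of \<open>l\<close> and \<open>m\<close>: its image
  under \<open>m\<close> is killed by \<open>j\<close> and so vanishes, hence \<open>x\<close> comes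
  from some \<open>y\<close> along \<open>l\<close>, and \<open>y\<close> is killed by
  \<open>i\<close>.\<close>

lemma gexact_epi_cmp:
  assumes f: "gexact i f" and g: "gexact j g" and fg: "src g = tgt f"
  shows "\<exists>k. gexact k (g \<cdot> f)"
proof -
  note cf = gexactD(1) [OF f] and cg = gexactD(1) [OF g]
  obtain k where k: "conf k (g \<cdot> f)" using conf_epi_cmp [OF cf cg fg] by blast
  obtain l m where m: "conf l m" "j \<cdot> m = f \<cdot> k" "k \<cdot> l = i" "tgt m = src j" "src m = src k"
    by (rule noether_conf_dual [OF cf cg k fg])
  note t = conf_typ [OF cf] conf_typ [OF cg] conf_typ [OF k] conf_typ [OF m(1)] fg m(4,5)
  have sl: "src l = src i" using t by (simp flip: m(3))
  have "gexact k (g \<cdot> f)"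
  proof (rule gexactI [OF k])
    fix x assume x: "x \<in> el (src k)" "Gm k x = \<zero>\<^bsub>Go (tgt k)\<^esub>"
    have "Gm j (Gm m x) = Gm (f \<cdot> k) x"
      unfolding m(2) [symmetric] using x t by (subst Gm_cmp) simp_all
    also have "\<dots> = \<zero>\<^bsub>Go (tgt j)\<^esub>"
      using x t by (subst Gm_cmp) simp_all
    finally have "Gm m x = \<zero>\<^bsub>Go (src j)\<^esub>"
      by (rule gexactD(2) [OF g, rotated]) (use x t Gm_closed [of m x] in simp_all)
    then have "Gm m x = \<zero>\<^bsub>Go (tgt m)\<^esub>"
      by (simp only: m(4))
    then obtain y where y: "y \<in> el (src l)" "Gm l y = x"
      by (rule Gm_conf_lift [OF m(1), rotated]) (use t x in simp_all)
    have "Gm i y = \<zero>\<^bsub>Go (tgt i)\<^esub>"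
      unfolding m(3) [symmetric] using x y t by (subst Gm_cmp) simp_all
    then have "y = \<zero>\<^bsub>Go (src i)\<^esub>"
      by (rule gexactD(2) [OF f, rotated]) (use y sl in simp)
    then show "x = \<zero>\<^bsub>Go (src k)\<^esub>"
      using y(2) t sl by auto
  next
    fix z assume "z \<in> el (tgt (g \<cdot> f))"
    then have "z \<in> el (tgt g)" using t by simp
    then obtain y where y: "y \<in> el (src g)" "Gm g y = z" by (rule gexact_lift [OF g])
    then obtain x where x: "x \<in> el (src f)" "Gm f x = y" using gexact_lift [OF f, of y] t by auto
    then show "\<exists>x \<in> el (src (g \<cdot> f)). Gm (g \<cdot> f) x = z"
      using x y t by (intro bexI [of _ x]) (simp_all add: Gm_cmp)
  qed
  then show ?thesis ..
qed

text \<open>Since \<open>p' \<cdot> f'\<close> is \<open>p\<close>, surjectivity passes from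
  \<open>p\<close> to \<open>p'\<close>. Injectivity of \<open>i'\<close> is the hard half and uses
  the biproduct conflation of the square.\<close>

lemma gexact_pushout:
  assumes g: "gexact i p" and sq: "pushout i f i' f'"
  shows "\<exists>p'. gexact i' p'"
proof -
  note ci = gexactD(1) [OF g]
  obtain p' where p': "conf i' p'" "p' \<cdot> f' = p" "tgt p' = tgt p" by (rule pushout_conf [OF ci sq])
  note t = conf_typ [OF ci] conf_typ [OF p'(1)] pushoutD(1-8) [OF sq] p'(3)
  obtain j k a b where bp: "biprod j k a b" "src j = tgt i" "src k = tgt f"
    using biprod_exists [of "tgt i" "tgt f"] t by auto
  note c = pushout_conf_biprod [OF ci sq bp]
  note B = biprodD(1-13) [OF bp(1)]
  have "gexact i' p'"
  proof (rule gexactI [OF p'(1)])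
    fix x assume x: "x \<in> el (src i')" "Gm i' x = \<zero>\<^bsub>Go (tgt i')\<^esub>"
    interpret T: abelian_group "Go (tgt f')" using t Go_group by simp
    \<comment> \<open>In biproduct coordinates this is (0, x); the deflation sends it to minus the
      image of \<open>x\<close> under \<open>i'\<close>, that is, to zero.\<close>
    define s where "s = Gm k x"
    have s: "s \<in> el (tgt j)" using Gm_closed [of k x] x t B bp by (simp add: s_def)
    have "(f' \<cdot> a \<boxplus> neg (i' \<cdot> b)) \<cdot> k = neg i'"
      using B bp t by (simp add: cmp_add_right cmp_assoc)
    then have "Gm (f' \<cdot> a \<boxplus> neg (i' \<cdot> b)) s = Gm (neg i') x"
      using Gm_cmp [of k "f' \<cdot> a \<boxplus> neg (i' \<cdot> b)" x] B bp t x by (simp add: s_def)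
    also have "\<dots> = \<zero>\<^bsub>Go (tgt (f' \<cdot> a \<boxplus> neg (i' \<cdot> b)))\<^esub>"
      using Gm_neg [of i' x] x t B bp by simp
    finally obtain z where z: "z \<in> el (src (j \<cdot> i \<boxplus> k \<cdot> f))" "Gm (j \<cdot> i \<boxplus> k \<cdot> f) z = s"
      by (rule Gm_conf_lift [OF c, rotated]) (use s t B bp in simp_all)
    have z': "z \<in> el (src i)" using z t B bp by simp
    \<comment> \<open>Comparing first coordinates: \<open>i\<close> sends \<open>z\<close> to zero,
      so \<open>z\<close>, and with it \<open>s\<close>, vanishes.\<close>
    have "a \<cdot> (j \<cdot> i \<boxplus> k \<cdot> f) = i"
      using B bp t by (simp add: cmp_add_left biprod_cmp [OF bp(1)])
    then have "Gm i z = Gm a s"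
      using Gm_cmp [of "j \<cdot> i \<boxplus> k \<cdot> f" a z] z B bp t by simp
    also have "\<dots> = \<zero>\<^bsub>Go (tgt i)\<^esub>"
      using Gm_cmp [of k a x] x t B bp by (simp add: s_def)
    finally have "z = \<zero>\<^bsub>Go (src i)\<^esub>" by (rule gexactD(2) [OF g z'])
    then have "s = \<zero>\<^bsub>Go (tgt j)\<^esub>" using z(2) t B bp by auto
    then have "Gm b s = \<zero>\<^bsub>Go (src i')\<^esub>" using t B bp by simp
    moreover have "Gm b s = x"
      using Gm_cmp [of k b x] x t B bp by (simp add: s_def Gm_one)
    ultimately show "x = \<zero>\<^bsub>Go (src i')\<^esub>" by simp
  next
    fix y assume "y \<in> el (tgt p')"
    then obtain x where x: "x \<in> el (src p)" "Gm p x = y" using gexact_lift [OF g, of y] t by auto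
    then show "\<exists>x \<in> el (src p'). Gm p' x = y"
      using Gm_cmp [of f' p' x] Gm_closed [of f' x] t p'(2) by (intro bexI [of _ "Gm f' x"]) simp_all
  qed
  then show ?thesis ..
qed

text \<open>Since \<open>f' \<cdot> i'\<close> is \<open>i\<close>, injectivity passes from
  \<open>i\<close> to \<open>i'\<close>. Surjectivity of \<open>p'\<close> uses the biproduct
  conflation that the pullback carries.\<close>

lemma gexact_pullback:
  assumes g: "gexact i p" and sq: "pullback p f p' f'"
  shows "\<exists>i'. gexact i' p'"
proof -
  note ci = gexactD(1) [OF g]
  obtain i' where i': "conf i' p'" "f' \<cdot> i' = i" "src i' = src i" by (rule pullback_conf [OF ci sq])
  note t = conf_typ [OF ci] conf_typ [OF i'(1)] i'(3)
  have P: "arr f" "arr f'" "tgt f = tgt p" "tgt f' = src p" "tgt p' = src f" "src p' = src f'"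
    using sq by (simp_all add: pushout_square_def)
  obtain j k a b where bp: "biprod j k a b" "src j = src p" "src k = src f"
    using biprod_exists [of "src p" "src f"] t P by auto
  note B = biprodD(1-13) [OF bp(1)]
  have c: "conf (j \<cdot> f' \<boxplus> neg (k \<cdot> p')) (p \<cdot> a \<boxplus> f \<cdot> b)"
    by (rule pullback_conf_biprod [OF ci sq bp(1)]) (use B bp in simp_all)
  have "gexact i' p'"
  proof (rule gexactI [OF i'(1)])
    fix x assume x: "x \<in> el (src i')" "Gm i' x = \<zero>\<^bsub>Go (tgt i')\<^esub>"
    have "Gm i x = \<zero>\<^bsub>Go (tgt i)\<^esub>"
      unfolding i'(2) [symmetric] using x t P by (subst Gm_cmp) simp_all
    then show "x = \<zero>\<^bsub>Go (src i')\<^esub>"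
      using gexactD(2) [OF g] x t by simp
  next
    fix y assume "y \<in> el (tgt p')"
    then have y: "y \<in> el (src f)" using P by simp
    have fy: "Gm f y \<in> el (tgt p)" using Gm_closed [of f y] y P by simp
    then obtain x where x: "x \<in> el (src p)" "Gm p x = Gm f y" by (rule gexact_lift [OF g])
    interpret S: abelian_group "Go (tgt j)" using B Go_group by simp
    interpret Q: abelian_group "Go (tgt p)" using t Go_group by simp
    interpret F: abelian_group "Go (src f)" using P Go_group by simp
    \<comment> \<open>In biproduct coordinates this is (x, -y); the deflation sends it to the
      difference of the images of \<open>x\<close> and \<open>y\<close> in the value at the target
      of \<open>p\<close>, which is zero by the choice of \<open>x\<close>.\<close>
    define s where "s = Gm j x \<oplus>\<^bsub>Go (tgt j)\<^esub> \<ominus>\<^bsub>Go (tgt j)\<^esub> Gm k y"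
    have jx: "Gm j x \<in> el (tgt j)" using Gm_closed [of j x] x B bp by simp
    have ky: "Gm k y \<in> el (tgt j)" using Gm_closed [of k y] y B bp by simp
    have s: "s \<in> el (tgt j)" using jx ky by (simp add: s_def)
    have Gs: "Gm h s = Gm (h \<cdot> j) x \<oplus>\<^bsub>Go (tgt h)\<^esub> \<ominus>\<^bsub>Go (tgt h)\<^esub> Gm (h \<cdot> k) y"
      if "arr h" "src h = tgt j" for h
      using that jx ky x y B bp Gm_hom [of h "Gm j x" "\<ominus>\<^bsub>Go (tgt j)\<^esub> Gm k y"] Gm_minus [of h "Gm k y"]
      by (simp add: s_def Gm_cmp)
    have pj: "(p \<cdot> a \<boxplus> f \<cdot> b) \<cdot> j = p"
      using B bp P t by (simp add: cmp_add_right cmp_assoc)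
    have fk: "(p \<cdot> a \<boxplus> f \<cdot> b) \<cdot> k = f"
      using B bp P t by (simp add: cmp_add_right cmp_assoc)
    have "Gm (p \<cdot> a \<boxplus> f \<cdot> b) s = \<zero>\<^bsub>Go (tgt (p \<cdot> a \<boxplus> f \<cdot> b))\<^esub>"
      using Gs [of "p \<cdot> a \<boxplus> f \<cdot> b"] B bp P t fy x(2) unfolding pj fk by (simp add: Q.r_neg)
    then obtain z where z: "z \<in> el (src (j \<cdot> f' \<boxplus> neg (k \<cdot> p')))" "Gm (j \<cdot> f' \<boxplus> neg (k \<cdot> p')) z = s"
      by (rule Gm_conf_lift [OF c, rotated]) (use s t B bp P in simp_all)
    have z': "z \<in> el (src p')" using z t B bp P by simp
    have pz: "Gm p' z \<in> el (src f)" using Gm_closed [of p' z] z' t P by simp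
    have bs: "Gm b s = \<ominus>\<^bsub>Go (src f)\<^esub> y"
      using Gs [of b] B bp x y P t by (simp add: Gm_one)
    \<comment> \<open>Comparing second coordinates: the sign in the inflation matches the sign put
      into \<open>s\<close>, so \<open>z\<close> lifts \<open>y\<close> itself.\<close>
    have "b \<cdot> (j \<cdot> f' \<boxplus> neg (k \<cdot> p')) = neg p'"
      using B bp P t by (simp add: cmp_add_left biprod_cmp [OF bp(1)])
    then have "Gm (neg p') z = Gm b s"
      using Gm_cmp [of "j \<cdot> f' \<boxplus> neg (k \<cdot> p')" b z] z B bp P t by simp
    then have "\<ominus>\<^bsub>Go (src f)\<^esub> Gm p' z = \<ominus>\<^bsub>Go (src f)\<^esub> y"
      using Gm_neg [of p' z] z' t P bs by simp
    then have "Gm p' z = y"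
      using F.minus_minus y pz by metis
    then show "\<exists>x \<in> el (src p'). Gm p' x = y"
      using z' by blast
  qed
  then show ?thesis ..
qed

lemma gexact_substructure: "exact_substructure Ob arr src tgt (\<cdot>) one zero (\<boxplus>) neg conf gexact"
proof (unfold_locales, goal_cases)
  case 1
  then show ?case by (rule gexactD)
next
  case 2
  then show ?case by (rule gexact_iso)
next
  case 3
  then show ?case by (rule gexact_one)
next
  case 4
  then show ?case by (rule gexact_one)
next
  case 5
  then show ?case by (rule gexact_mono_cmp)
next
  case 6
  then show ?case by (rule gexact_epi_cmp)
next
  case 7
  then show ?case by (rule gexact_pushout)
next
  case 8
  then show ?case by (rule gexact_pullback)
qed

end

section \<open>Module homomorphisms as the arrows of a preadditive category\<close>

text \<open>The endpoints are stored because an extensional function determines neither its codomain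
  nor the module structure on its domain.\<close>

type_synonym ('r, 'm) mod_arrow = "('r, 'm) module \<times> ('m \<Rightarrow> 'm) \<times> ('r, 'm) module"

fun is_arrow :: "('r, 'x) ring_scheme \<Rightarrow> ('r, 'm) module set \<Rightarrow> ('r, 'm) mod_arrow \<Rightarrow> bool" where
  "is_arrow R X (A, f, B) \<longleftrightarrow> A \<in> X \<and> B \<in> X \<and> f \<in> mod_hom R A B"

fun arrow_src :: "('r, 'm) mod_arrow \<Rightarrow> ('r, 'm) module" where "arrow_src (A, f, B) = A"

fun arrow_tgt :: "('r, 'm) mod_arrow \<Rightarrow> ('r, 'm) module" where "arrow_tgt (A, f, B) = B"

text \<open>The middle objects are not compared, since the laws of \<open>preadditive\<close>
  concern composable arrows only; \<open>arrow_conf\<close> carries no such guard and does compare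
  them.\<close>

fun arrow_cmp :: "('r, 'm) mod_arrow \<Rightarrow> ('r, 'm) mod_arrow \<Rightarrow> ('r, 'm) mod_arrow" where
  "arrow_cmp (B', g, C) (A, f, B) = (A, compose (carrier A) g f, C)"

fun arrow_add :: "('r, 'm) mod_arrow \<Rightarrow> ('r, 'm) mod_arrow \<Rightarrow> ('r, 'm) mod_arrow" where
  "arrow_add (A, f, B) (A', g, B') = (A, add_hom A B f g, B)"

fun arrow_neg :: "('r, 'm) mod_arrow \<Rightarrow> ('r, 'm) mod_arrow" where
  "arrow_neg (A, f, B) = (A, \<lambda>x\<in>carrier A. \<ominus>\<^bsub>B\<^esub> f x, B)"

lemma arrow_ex:
  assumes "arrow_src f = A" "arrow_tgt f = B"
  obtains a where "f = (A, a, B)"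
  using assms by (metis arrow_src.simps arrow_tgt.simps prod_cases3)

lemma arrow_cospan:
  assumes "arrow_src f = A" "arrow_src g = B" "arrow_tgt f = arrow_tgt g"
  obtains T a b where "f = (A, a, T)" "g = (B, b, T)"
  using assms arrow_ex by metis

lemma arrow_span:
  assumes "arrow_tgt f = A" "arrow_tgt g = B" "arrow_src f = arrow_src g"
  obtains T a b where "f = (T, a, A)" "g = (T, b, B)"
  using assms arrow_ex by metis

definition arrow_one :: "('r, 'm) module \<Rightarrow> ('r, 'm) mod_arrow" where
  "arrow_one A = (A, id_hom A, A)"

definition arrow_zero :: "('r, 'm) module \<Rightarrow> ('r, 'm) module \<Rightarrow> ('r, 'm) mod_arrow" where
  "arrow_zero A B = (A, zero_hom A B, B)"

fun arrow_conf :: "('r, 'm) mod_seq set \<Rightarrow> ('r, 'm) mod_arrow \<Rightarrow> ('r, 'm) mod_arrow \<Rightarrow> bool" where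
  "arrow_conf E (A, i, B) (B', p, C) \<longleftrightarrow> B' = B \<and> (A, i, B, p, C) \<in> E"

section \<open>Homomorphisms form a preadditive category\<close>

lemma mod_homD:
  assumes "f \<in> mod_hom R M N"
  shows "x \<in> carrier M \<Longrightarrow> f x \<in> carrier N" "x \<notin> carrier M \<Longrightarrow> f x = undefined"
    "x \<in> carrier M \<Longrightarrow> y \<in> carrier M \<Longrightarrow> f (x \<oplus>\<^bsub>M\<^esub> y) = f x \<oplus>\<^bsub>N\<^esub> f y"
    "a \<in> carrier R \<Longrightarrow> x \<in> carrier M \<Longrightarrow> f (a \<odot>\<^bsub>M\<^esub> x) = a \<odot>\<^bsub>N\<^esub> f x"
  using assms by (auto simp: mod_hom_def PiE_iff extensional_def)

lemma mod_homI:
  assumes "\<And>x. x \<in> carrier M \<Longrightarrow> f x \<in> carrier N" "\<And>x. x \<notin> carrier M \<Longrightarrow> f x = undefined"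
    "\<And>x y. x \<in> carrier M \<Longrightarrow> y \<in> carrier M \<Longrightarrow> f (x \<oplus>\<^bsub>M\<^esub> y) = f x \<oplus>\<^bsub>N\<^esub> f y"
    "\<And>a x. a \<in> carrier R \<Longrightarrow> x \<in> carrier M \<Longrightarrow> f (a \<odot>\<^bsub>M\<^esub> x) = a \<odot>\<^bsub>N\<^esub> f x"
  shows "f \<in> mod_hom R M N"
  using assms by (auto simp: mod_hom_def PiE_iff extensional_def)

lemma mod_hom_compose [simp]:
  assumes "f \<in> mod_hom R A B" "g \<in> mod_hom R B C" "module R A"
  shows "compose (carrier A) g f \<in> mod_hom R A C"
proof -
  interpret module R A by fact
  show ?thesis
    by (rule mod_homI) (simp_all add: compose_def mod_homD [OF assms(1)] mod_homD [OF assms(2)])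
qed

lemma mod_hom_id [simp]: "module R A \<Longrightarrow> id_hom A \<in> mod_hom R A A"
proof -
  assume "module R A"
  then interpret module R A .
  show ?thesis by (rule mod_homI) (simp_all add: id_hom_def)
qed

lemma mod_hom_zero [simp]:
  assumes "module R A" "module R B"
  shows "zero_hom A B \<in> mod_hom R A B"
proof -
  interpret A: module R A by fact
  interpret B: module R B by fact
  show ?thesis by (rule mod_homI) (simp_all add: zero_hom_def)
qed

lemma mod_hom_add [simp]:
  assumes "module R A" "module R B" "f \<in> mod_hom R A B" "g \<in> mod_hom R A B"
  shows "add_hom A B f g \<in> mod_hom R A B"
proof -
  interpret A: module R A by fact
  interpret B: module R B by fact
  show ?thesis
    by (rule mod_homI)
      (simp_all add: add_hom_def mod_homD [OF assms(3)] mod_homD [OF assms(4)] B.M.a_ac B.smult_r_distr)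
qed

lemma mod_hom_neg [simp]:
  assumes "module R A" "module R B" "f \<in> mod_hom R A B"
  shows "(\<lambda>x\<in>carrier A. \<ominus>\<^bsub>B\<^esub> f x) \<in> mod_hom R A B"
proof -
  interpret A: module R A by fact
  interpret B: module R B by fact
  show ?thesis
    by (rule mod_homI) (simp_all add: mod_homD [OF assms(3)] B.M.minus_add B.smult_r_minus)
qed

text \<open>Arrows are extensional, so each law reduces to a pointwise identity on the carrier of
  the source.\<close>

lemma preadditive_modules:
  assumes mod: "\<And>M. M \<in> X \<Longrightarrow> module R M"
  shows "preadditive X (is_arrow R X) arrow_src arrow_tgt arrow_cmp arrow_one arrow_zero arrow_add arrow_neg"
proof -
  have grp: "abelian_group M" if "M \<in> X" for M
    using mod [OF that] by (rule module.axioms)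
  note D = mod_homD(1,3)
  show ?thesis
  proof (unfold_locales, goal_cases)
    case (9 f g h)
    then show ?case
      by (cases f; cases g; cases h)
        (auto simp: compose_def fun_eq_iff dest: D)
  next
    case (10 f A)
    then show ?case
      by (cases f) (auto simp: compose_def arrow_one_def id_hom_def fun_eq_iff dest: mod_homD(2))
  next
    case (11 f A')
    obtain A a B where e: "f = (A, a, B)" by (rule prod_cases3)
    then have a: "a \<in> mod_hom R A B" using 11 by simp
    have "compose (carrier A) (id_hom B) a = a"
    proof
      show "compose (carrier A) (id_hom B) a x = a x" for x
        by (cases "x \<in> carrier A") (simp_all add: compose_def id_hom_def mod_homD(1,2) [OF a])
    qed
    then show ?case using 11(2) by (simp add: e arrow_one_def)
  next
    case (21 f g h)
    obtain A a B b c where e: "f = (A, a, B)" "g = (A, b, B)" "h = (A, c, B)"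
      using 21(4-7) arrow_ex by metis
    interpret abelian_group B using 21 grp by (simp add: e)
    show ?case using 21 by (auto simp: e add_hom_def fun_eq_iff a_assoc mod_homD(1) [of _ R A B])
  next
    case (22 f g)
    obtain A a B b where e: "f = (A, a, B)" "g = (A, b, B)"
      using 22(3,4) arrow_ex by metis
    interpret abelian_group B using 22 grp by (simp add: e)
    show ?case using 22 by (auto simp: e add_hom_def fun_eq_iff a_comm mod_homD(1) [of _ R A B])
  next
    case (23 f A' B')
    obtain A a B where e: "f = (A, a, B)" by (rule prod_cases3)
    interpret abelian_group B using 23 grp by (simp add: e)
    show ?case using 23 by (auto simp: e arrow_zero_def zero_hom_def add_hom_def fun_eq_iff dest: mod_homD(1,2))
  next
    case (24 f)
    obtain A a B where e: "f = (A, a, B)" by (rule prod_cases3)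
    interpret abelian_group B using 24 grp by (simp add: e)
    show ?case using 24 by (auto simp: e arrow_zero_def zero_hom_def add_hom_def fun_eq_iff r_neg dest: mod_homD(1))
  next
    case (25 f g h)
    obtain A a B b C c where e: "f = (A, a, B)" "g = (A, b, B)" "h = (B, c, C)"
      using 25(4-6) arrow_ex by metis
    interpret abelian_group B using 25 grp by (simp add: e)
    show ?case using 25 by (auto simp: e add_hom_def compose_def fun_eq_iff dest: D)
  next
    case (26 f g h)
    obtain A a B b C c where e: "f = (A, a, B)" "g = (A, b, B)" "h = (C, c, A)"
      using 26(4-6) arrow_ex by metis
    show ?case using 26 by (auto simp: e add_hom_def compose_def fun_eq_iff dest: D)
  qed (auto simp: arrow_one_def arrow_zero_def mod)
qed

section \<open>Exact subcategories of module categories\<close>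

locale module_exact_cat =
  fixes R :: "('r, 'x) ring_scheme" and X :: "('r, 'm) module set" and E :: "('r, 'm) mod_seq set"
  assumes exact_subcategory: "exact_subcategory R X E"
begin

lemma mod: "M \<in> X \<Longrightarrow> module R M"
  using exact_subcategory by (simp add: exact_subcategory_def additive_subcategory_def)

sublocale preadditive X "is_arrow R X" arrow_src arrow_tgt arrow_cmp arrow_one arrow_zero arrow_add arrow_neg
  by (rule preadditive_modules) (rule mod)

section \<open>From concrete module notions to categorical ones\<close>

lemma inverses_mod_iso:
  assumes "inverses (A, f, B) a'"
  shows "f \<in> mod_iso R A B"
proof -
  have t: "is_arrow R X (A, f, B)" "is_arrow R X a'" "arrow_src a' = B" "arrow_tgt a' = A"
    and inv: "arrow_cmp a' (A, f, B) = arrow_one A" "arrow_cmp (A, f, B) a' = arrow_one B"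
    using assms by (simp_all add: inverses_def)
  obtain g where g: "a' = (B, g, A)" using t(3,4) by (rule arrow_ex)
  have "compose (carrier A) g f = id_hom A" "compose (carrier B) f g = id_hom B"
    using inv by (simp_all add: g arrow_one_def)
  then have "g (f x) = x" if "x \<in> carrier A" for x
    using that by (metis compose_eq id_hom_def restrict_apply')
  moreover have "f (g y) = y" if "y \<in> carrier B" for y
    using that \<open>compose (carrier B) f g = id_hom B\<close> by (metis compose_eq id_hom_def restrict_apply')
  moreover have f: "f \<in> mod_hom R A B" and "g \<in> mod_hom R B A" using t g by simp_all
  ultimately have "bij_betw f (carrier A) (carrier B)"
    by (intro bij_betw_byWitness [where f' = g]) (auto dest: mod_homD(1))
  then show ?thesis using f by (simp add: mod_iso_def)
qed

lemma mod_iso_inverses: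
  assumes "f \<in> mod_iso R A B" "A \<in> X" "B \<in> X"
  obtains a' where "inverses (A, f, B) a'"
proof -
  interpret A: module R A using mod assms by simp
  interpret B: module R B using mod assms by simp
  have f: "f \<in> mod_hom R A B" and bij: "bij_betw f (carrier A) (carrier B)"
    using assms by (simp_all add: mod_iso_def)
  define g where "g = restrict (inv_into (carrier A) f) (carrier B)"
  have gc: "g y \<in> carrier A" and fg: "f (g y) = y" if "y \<in> carrier B" for y
    using that bij by (simp_all add: g_def bij_betw_def inv_into_into f_inv_into_f)
  have gf: "g (f x) = x" if "x \<in> carrier A" for x
    using that bij mod_homD(1) [OF f] by (simp add: g_def bij_betw_def)
  \<comment> \<open>A value of \<open>g\<close> is recognised by its image under \<open>f\<close>,
    so the homomorphism laws of \<open>g\<close> reduce to those of \<open>f\<close>.\<close>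
  have g_eq: "g y = x" if "x \<in> carrier A" "f x = y" for x y
    using gf that by blast
  have g: "g \<in> mod_hom R B A"
  proof (rule mod_homI)
    show "g (x \<oplus>\<^bsub>B\<^esub> y) = g x \<oplus>\<^bsub>A\<^esub> g y" if "x \<in> carrier B" "y \<in> carrier B" for x y
      using that by (intro g_eq) (simp_all add: gc fg mod_homD [OF f])
    show "g (a \<odot>\<^bsub>B\<^esub> x) = a \<odot>\<^bsub>A\<^esub> g x" if "a \<in> carrier R" "x \<in> carrier B" for a x
      using that by (intro g_eq) (simp_all add: gc fg mod_homD [OF f])
  qed (simp_all add: gc, simp add: g_def)
  have "compose (carrier A) g f = id_hom A" "compose (carrier B) f g = id_hom B"
    using gf fg by (auto simp: compose_def id_hom_def fun_eq_iff)
  then have "inverses (A, f, B) (B, g, A)"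
    using f g assms by (simp add: inverses_def arrow_one_def)
  then show ?thesis by (rule that)
qed

lemma biprod_modules:
  assumes "biproduct R M N P" "M \<in> X" "N \<in> X" "P \<in> X"
  shows "\<exists>i j p q. biprod i j p q \<and> arrow_src i = M \<and> arrow_src j = N"
proof -
  obtain i j p q where "i \<in> mod_hom R M P" "j \<in> mod_hom R N P" "p \<in> mod_hom R P M" "q \<in> mod_hom R P N"
    "compose (carrier M) p i = id_hom M" "compose (carrier N) q j = id_hom N"
    "compose (carrier N) p j = zero_hom N M" "compose (carrier M) q i = zero_hom M N"
    "add_hom P P (compose (carrier P) i p) (compose (carrier P) j q) = id_hom P"
    using assms(1) unfolding biproduct_def by blast
  then have "biprod (M, i, P) (N, j, P) (P, p, M) (P, q, N)"
    using assms(2-) by (simp add: biprod_def arrow_one_def arrow_zero_def)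
  then show ?thesis by (metis arrow_src.simps)
qed

text \<open>The concrete definition asserts unique existence for each cocone, the abstract one
  existence and joint cancellability. The second is obtained by applying uniqueness to the cocone
  that an arrow out of the corner induces.\<close>

lemma pushout_modules:
  assumes "is_pushout R X A B A' B' i f i' f'" "A \<in> X" "B \<in> X" "A' \<in> X" "B' \<in> X"
    "i \<in> mod_hom R A B" "f \<in> mod_hom R A A'"
  shows "pushout (A, i, B) (A, f, A') (A', i', B') (B, f', B')"
proof -
  have i': "i' \<in> mod_hom R A' B'" and f': "f' \<in> mod_hom R B B'"
    and sq: "compose (carrier A) f' i = compose (carrier A) i' f"
    and univ: "\<And>T u v. T \<in> X \<Longrightarrow> u \<in> mod_hom R B T \<Longrightarrow> v \<in> mod_hom R A' T \<Longrightarrow>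
      compose (carrier A) u i = compose (carrier A) v f \<Longrightarrow>
      \<exists>!w. w \<in> mod_hom R B' T \<and> compose (carrier B) w f' = u \<and> compose (carrier A') w i' = v"
    using assms(1) unfolding is_pushout_def by auto
  let ?i = "(A, i, B)" and ?f = "(A, f, A')" and ?i' = "(A', i', B')" and ?f' = "(B, f', B')"
  have t: "is_arrow R X ?i" "is_arrow R X ?f" "is_arrow R X ?i'" "is_arrow R X ?f'"
    using assms i' f' by simp_all
  show ?thesis
    unfolding pushout_square_def
  proof (intro conjI allI impI, goal_cases)
    case (10 u v)
    obtain T u0 v0 where e: "u = (B, u0, T)" "v = (A', v0, T)"
      by (rule arrow_cospan [of u _ v]) (use 10 in simp_all)
    have "\<exists>!w. w \<in> mod_hom R B' T \<and> compose (carrier B) w f' = u0 \<and> compose (carrier A') w i' = v0"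
      by (rule univ) (use 10 e in simp_all)
    then obtain w where "w \<in> mod_hom R B' T" "compose (carrier B) w f' = u0" "compose (carrier A') w i' = v0"
      by blast
    then show ?case using 10 assms e by (intro exI [of _ "(B', w, T)"]) simp
  next
    case (11 w w')
    obtain T w0 w1 where e: "w = (B', w0, T)" "w' = (B', w1, T)"
      by (rule arrow_cospan [of w _ w']) (use 11 in simp_all)
    have w: "T \<in> X" "w0 \<in> mod_hom R B' T" "w1 \<in> mod_hom R B' T"
      using 11 e by simp_all
    \<comment> \<open>The composites of \<open>w\<close> with the two legs form a cocone, as
      uniqueness requires.\<close>
    have "arrow_cmp (arrow_cmp w ?f') ?i = arrow_cmp w (arrow_cmp ?f' ?i)"
      by (rule cmp_assoc) (use t e w in simp_all)
    also have "\<dots> = arrow_cmp w (arrow_cmp ?i' ?f)"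
      using sq by simp
    also have "\<dots> = arrow_cmp (arrow_cmp w ?i') ?f"
      by (rule cmp_assoc [symmetric]) (use t e w in simp_all)
    finally have "arrow_cmp (arrow_cmp w ?f') ?i = arrow_cmp (arrow_cmp w ?i') ?f" .
    then have "\<exists>!w. w \<in> mod_hom R B' T \<and> compose (carrier B) w f' = compose (carrier B) w0 f' \<and>
        compose (carrier A') w i' = compose (carrier A') w0 i'"
      by (intro univ) (use w i' f' assms mod e in simp_all)
    then have "w0 = w1" using w 11 e by auto
    then show ?case by (simp add: e)
  qed (use t sq in simp_all)
qed

lemma pullback_modules:
  assumes "is_pullback R X B C B' C' p f p' f'" "B \<in> X" "C \<in> X" "B' \<in> X" "C' \<in> X"
    "p \<in> mod_hom R B C" "f \<in> mod_hom R C' C"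
  shows "pullback (B, p, C) (C', f, C) (B', p', C') (B', f', B)"
proof -
  have p': "p' \<in> mod_hom R B' C'" and f': "f' \<in> mod_hom R B' B"
    and sq: "compose (carrier B') p f' = compose (carrier B') f p'"
    and univ: "\<And>T u v. T \<in> X \<Longrightarrow> u \<in> mod_hom R T B \<Longrightarrow> v \<in> mod_hom R T C' \<Longrightarrow>
      compose (carrier T) p u = compose (carrier T) f v \<Longrightarrow>
      \<exists>!w. w \<in> mod_hom R T B' \<and> compose (carrier T) f' w = u \<and> compose (carrier T) p' w = v"
    using assms(1) unfolding is_pullback_def by auto
  let ?p = "(B, p, C)" and ?f = "(C', f, C)" and ?p' = "(B', p', C')" and ?f' = "(B', f', B)"
  have t: "is_arrow R X ?p" "is_arrow R X ?f" "is_arrow R X ?p'" "is_arrow R X ?f'"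
    using assms p' f' by simp_all
  show ?thesis
    unfolding pushout_square_def
  proof (intro conjI allI impI, goal_cases)
    case (10 u v)
    obtain T u0 v0 where e: "u = (T, u0, B)" "v = (T, v0, C')"
      by (rule arrow_span [of u _ v]) (use 10 in simp_all)
    have "\<exists>!w. w \<in> mod_hom R T B' \<and> compose (carrier T) f' w = u0 \<and> compose (carrier T) p' w = v0"
      by (rule univ) (use 10 e in simp_all)
    then obtain w where "w \<in> mod_hom R T B'" "compose (carrier T) f' w = u0" "compose (carrier T) p' w = v0"
      by blast
    then show ?case using 10 assms e by (intro exI [of _ "(T, w, B')"]) simp
  next
    case (11 w w')
    obtain T w0 w1 where e: "w = (T, w0, B')" "w' = (T, w1, B')"
      by (rule arrow_span [of w _ w']) (use 11 in simp_all)
    have w: "T \<in> X" "w0 \<in> mod_hom R T B'" "w1 \<in> mod_hom R T B'"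
      using 11 e by simp_all
    \<comment> \<open>Dually, the composites of the two legs with \<open>w\<close> form a
      cone.\<close>
    have "arrow_cmp (arrow_cmp ?p ?f') w = arrow_cmp (arrow_cmp ?f ?p') w"
      using sq by simp
    moreover have "arrow_cmp (arrow_cmp ?p ?f') w = arrow_cmp ?p (arrow_cmp ?f' w)"
      by (rule cmp_assoc) (use t e w in simp_all)
    moreover have "arrow_cmp (arrow_cmp ?f ?p') w = arrow_cmp ?f (arrow_cmp ?p' w)"
      by (rule cmp_assoc) (use t e w in simp_all)
    ultimately have "arrow_cmp ?p (arrow_cmp ?f' w) = arrow_cmp ?f (arrow_cmp ?p' w)"
      by (simp only:)
    then have "\<exists>!w. w \<in> mod_hom R T B' \<and> compose (carrier T) f' w = compose (carrier T) f' w0 \<and>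
        compose (carrier T) p' w = compose (carrier T) p' w0"
      by (intro univ) (use w p' f' assms mod e in simp_all)
    then have "w0 = w1" using w 11 e by auto
    then show ?case by (simp add: e)
  qed (use t sq in simp_all)
qed

lemma exact_structure: "exact_structure R X E"
  using exact_subcategory by (simp add: exact_subcategory_def)

lemmas structure_conjuncts = exact_structure [unfolded exact_structure_def]
lemmas seq_kernel_cokernel = structure_conjuncts [THEN conjunct1, rule_format]
lemmas seq_iso = structure_conjuncts [THEN conjunct2, THEN conjunct1, rule_format, OF _ conjI]
lemmas adm_monic_id = structure_conjuncts [THEN conjunct2, THEN conjunct2, THEN conjunct1, rule_format]
lemmas adm_epic_id =
  structure_conjuncts [THEN conjunct2, THEN conjunct2, THEN conjunct2, THEN conjunct1, rule_format]
lemmas adm_monic_compose =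
  structure_conjuncts [THEN conjunct2, THEN conjunct2, THEN conjunct2, THEN conjunct2, THEN conjunct1, rule_format, OF conjI]
lemmas adm_epic_compose =
  structure_conjuncts [THEN conjunct2, THEN conjunct2, THEN conjunct2, THEN conjunct2, THEN conjunct2,
    THEN conjunct1, rule_format, OF conjI]
lemmas adm_monic_pushout =
  structure_conjuncts [THEN conjunct2, THEN conjunct2, THEN conjunct2, THEN conjunct2, THEN conjunct2,
    THEN conjunct2, THEN conjunct1, rule_format]
lemmas adm_epic_pullback =
  structure_conjuncts [THEN conjunct2, THEN conjunct2, THEN conjunct2, THEN conjunct2, THEN conjunct2,
    THEN conjunct2, THEN conjunct2, rule_format]

lemma conf_cases:
  assumes "arrow_conf E i p"
  obtains A a B b C where "i = (A, a, B)" "p = (B, b, C)" "(A, a, B, b, C) \<in> E"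
  using assms by (cases i; cases p) auto

lemma seqD:
  assumes "(A, i, B, p, C) \<in> E"
  shows "A \<in> X" "B \<in> X" "C \<in> X" "i \<in> mod_hom R A B" "p \<in> mod_hom R B C"
    "is_kernel R X (A, i, B, p, C)" "is_cokernel R X (A, i, B, p, C)"
    "compose (carrier A) p i = zero_hom A C"
proof -
  from seq_kernel_cokernel [OF assms] show "A \<in> X" "B \<in> X" "C \<in> X" "i \<in> mod_hom R A B" "p \<in> mod_hom R B C"
    "is_kernel R X (A, i, B, p, C)" "is_cokernel R X (A, i, B, p, C)"
    "compose (carrier A) p i = zero_hom A C"
    by (simp_all add: kernel_cokernel_pair_def is_kernel_def)
qed

sublocale exact_cat X "is_arrow R X" arrow_src arrow_tgt arrow_cmp arrow_one arrow_zero arrow_add arrow_neg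
  "arrow_conf E"
proof (unfold_locales, goal_cases)
  case (5 i p f)
  then obtain A a B b C where e: "i = (A, a, B)" "p = (B, b, C)" "(A, a, B, b, C) \<in> E"
    by (elim conf_cases)
  note s = seqD [OF e(3)]
  obtain T f0 where f: "f = (T, f0, B)" by (rule arrow_ex [of f "arrow_src f" B]) (use 5 e in simp_all)
  have "T \<in> X" "f0 \<in> mod_hom R T B" "compose (carrier T) b f0 = zero_hom T C"
    using 5(2,4) by (simp_all add: e f arrow_zero_def)
  then have "\<exists>!g. g \<in> mod_hom R T A \<and> compose (carrier T) a g = f0"
    using s(6) by (simp add: is_kernel_def)
  then obtain g where "g \<in> mod_hom R T A" "compose (carrier T) a g = f0" by blast
  then show ?case using 5 e f s by (intro exI [of _ "(T, g, A)"]) simp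
next
  case (6 i p g h)
  then obtain A a B b C where e: "i = (A, a, B)" "p = (B, b, C)" "(A, a, B, b, C) \<in> E"
    by (elim conf_cases)
  note s = seqD [OF e(3)]
  obtain T g0 h0 where f: "g = (T, g0, A)" "h = (T, h0, A)"
    by (rule arrow_span [of g A h A]) (use 6 e in simp_all)
  have T: "T \<in> X" "g0 \<in> mod_hom R T A" "h0 \<in> mod_hom R T A" using 6 f by simp_all
  have pi: "arrow_cmp p i = arrow_zero A C"
    by (simp add: e arrow_zero_def s(8))
  \<comment> \<open>Uniqueness in \<open>is_kernel\<close> concerns factorisations of arrows killed
    by \<open>p\<close>; it yields left cancellation once it is applied to \<open>i\<close> composed
    with \<open>g\<close>.\<close>
  have "arrow_cmp p (arrow_cmp i g) = arrow_cmp (arrow_cmp p i) g"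
    by (rule cmp_assoc [symmetric]) (use e s(1-5) f T in simp_all)
  also have "\<dots> = arrow_zero T C"
    unfolding pi f by (subst zero_cmp) (use s(1-5) T in simp_all)
  finally have "arrow_cmp p (arrow_cmp i g) = arrow_zero T C" .
  then have "\<exists>!g. g \<in> mod_hom R T A \<and> compose (carrier T) a g = compose (carrier T) a g0"
    using s(1,2,4,6) T e f mod by (simp add: is_kernel_def arrow_zero_def)
  then have "g0 = h0" using T 6 e f by auto
  then show ?case by (simp add: f)
next
  case (7 i p f)
  then obtain A a B b C where e: "i = (A, a, B)" "p = (B, b, C)" "(A, a, B, b, C) \<in> E"
    by (elim conf_cases)
  note s = seqD [OF e(3)]
  obtain T f0 where f: "f = (B, f0, T)" by (rule arrow_ex [of f B "arrow_tgt f"]) (use 7 e in simp_all)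
  have "T \<in> X" "f0 \<in> mod_hom R B T" "compose (carrier A) f0 a = zero_hom A T"
    using 7(2,4) by (simp_all add: e f arrow_zero_def)
  then have "\<exists>!g. g \<in> mod_hom R C T \<and> compose (carrier B) g b = f0"
    using s(7) by (simp add: is_cokernel_def)
  then obtain g where "g \<in> mod_hom R C T" "compose (carrier B) g b = f0" by blast
  then show ?case using 7 e f s by (intro exI [of _ "(C, g, T)"]) simp
next
  case (8 i p g h)
  then obtain A a B b C where e: "i = (A, a, B)" "p = (B, b, C)" "(A, a, B, b, C) \<in> E"
    by (elim conf_cases)
  note s = seqD [OF e(3)]
  obtain T g0 h0 where f: "g = (C, g0, T)" "h = (C, h0, T)"
    by (rule arrow_cospan [of g C h C]) (use 8 e in simp_all)
  have T: "T \<in> X" "g0 \<in> mod_hom R C T" "h0 \<in> mod_hom R C T" using 8 f by simp_all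
  have pi: "arrow_cmp p i = arrow_zero A C"
    by (simp add: e arrow_zero_def s(8))
  \<comment> \<open>The dual argument: \<open>g\<close> composed with \<open>p\<close> is killed by
    \<open>i\<close>, so uniqueness in \<open>is_cokernel\<close> applies to it.\<close>
  have "arrow_cmp (arrow_cmp g p) i = arrow_cmp g (arrow_cmp p i)"
    by (rule cmp_assoc) (use e s(1-5) f T in simp_all)
  also have "\<dots> = arrow_zero A T"
    unfolding pi f by (subst cmp_zero) (use s(1-5) T in simp_all)
  finally have "arrow_cmp (arrow_cmp g p) i = arrow_zero A T" .
  then have "\<exists>!g. g \<in> mod_hom R C T \<and> compose (carrier B) g b = compose (carrier B) g0 b"
    using s(2,3,5,7) T e f mod by (simp add: is_cokernel_def arrow_zero_def)
  then have "g0 = h0" using T 8 e f by auto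
  then show ?case by (simp add: f)
next
  case (9 i p a a' b b' c c' i' p')
  obtain A i0 B p0 C where e: "i = (A, i0, B)" "p = (B, p0, C)" "(A, i0, B, p0, C) \<in> E"
    using 9(1) by (elim conf_cases)
  have src: "arrow_src a = A" "arrow_src b = B" "arrow_src c = C" using 9(11-13) e by simp_all
  obtain A' B' C' a0 b0 c0 where f1: "a = (A, a0, A')" "b = (B, b0, B')" "c = (C, c0, C')"
    using src arrow_ex by metis
  have "arrow_src i' = A'" "arrow_tgt i' = B'" "arrow_src p' = B'" "arrow_tgt p' = C'"
    using 9(7-10) f1 by simp_all
  then obtain i1 p1 where f2: "i' = (A', i1, B')" "p' = (B', p1, C')"
    using arrow_ex by metis
  note f = f1 f2
  have "a0 \<in> mod_iso R A A'" "b0 \<in> mod_iso R B B'" "c0 \<in> mod_iso R C C'"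
    using 9(2-4) by (auto simp: f intro: inverses_mod_iso)
  then have "seq_isomorphic R (A, i0, B, p0, C) (A', i1, B', p1, C')"
    using 9(14,15) by (auto simp: seq_isomorphic_def e f)
  moreover have "seq_in R X (A', i1, B', p1, C')"
    using 9(5,6) by (simp add: seq_in_def f)
  ultimately have "(A', i1, B', p1, C') \<in> E"
    by (intro seq_iso [OF e(3)])
  then show ?case by (simp add: f)
next
  case (10 A)
  then have "adm_monic E A A (id_hom A)"
    by (rule adm_monic_id)
  then obtain p C where "(A, id_hom A, A, p, C) \<in> E"
    by (auto simp: adm_monic_def)
  then show ?case by (intro exI [of _ "(A, p, C)"]) (simp add: arrow_one_def)
next
  case (11 A)
  then have "adm_epic E A A (id_hom A)"
    by (rule adm_epic_id)
  then obtain i K where "(K, i, A, id_hom A, A) \<in> E"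
    by (auto simp: adm_epic_def)
  then show ?case by (intro exI [of _ "(K, i, A)"]) (simp add: arrow_one_def)
next
  case (12 f p g q)
  obtain A f0 B p0 C where f: "f = (A, f0, B)" "p = (B, p0, C)" "(A, f0, B, p0, C) \<in> E"
    using 12(1) by (elim conf_cases)
  obtain B' g0 D q0 F where g: "g = (B', g0, D)" "q = (D, q0, F)" "(B', g0, D, q0, F) \<in> E"
    using 12(2) by (elim conf_cases)
  have "adm_monic E A D (compose (carrier A) g0 f0)"
    by (rule adm_monic_compose [of _ B]) (use f g 12(3) in \<open>auto simp: adm_monic_def\<close>)
  then obtain r H where "(A, compose (carrier A) g0 f0, D, r, H) \<in> E"
    by (auto simp: adm_monic_def)
  then show ?case by (intro exI [of _ "(D, r, H)"]) (simp add: f g)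
next
  case (13 i f j g)
  obtain A i0 B f0 C where f: "i = (A, i0, B)" "f = (B, f0, C)" "(A, i0, B, f0, C) \<in> E"
    using 13(1) by (elim conf_cases)
  obtain J j0 C' g0 D where g: "j = (J, j0, C')" "g = (C', g0, D)" "(J, j0, C', g0, D) \<in> E"
    using 13(2) by (elim conf_cases)
  have "adm_epic E B D (compose (carrier B) g0 f0)"
    by (rule adm_epic_compose [of _ C]) (use f g 13(3) in \<open>auto simp: adm_epic_def\<close>)
  then obtain k K where "(K, k, B, compose (carrier B) g0 f0, D) \<in> E"
    by (auto simp: adm_epic_def)
  then show ?case by (intro exI [of _ "(K, k, B)"]) (simp add: f g)
next
  case (14 i p f)
  obtain A i0 B p0 C where e: "i = (A, i0, B)" "p = (B, p0, C)" "(A, i0, B, p0, C) \<in> E"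
    using 14(1) by (elim conf_cases)
  obtain f0 A' where f: "f = (A, f0, A')" by (rule arrow_ex [of f A "arrow_tgt f"]) (use 14 e in simp_all)
  have "adm_monic E A B i0" "A' \<in> X" "f0 \<in> mod_hom R A A'"
    using e 14 f by (auto simp: adm_monic_def)
  then obtain B' i1 f1 where po: "B' \<in> X" "is_pushout R X A B A' B' i0 f0 i1 f1" "adm_monic E A' B' i1"
    using adm_monic_pushout by blast
  then obtain q D where q: "(A', i1, B', q, D) \<in> E"
    by (auto simp: adm_monic_def)
  have "pushout i f (A', i1, B') (B, f1, B')"
    unfolding e f by (rule pushout_modules) (use po seqD [OF e(3)] 14 f in simp_all)
  moreover have "arrow_conf E (A', i1, B') (B', q, D)" using q by simp
  ultimately show ?case by blast
next
  case (15 i p f)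
  obtain A i0 B p0 C where e: "i = (A, i0, B)" "p = (B, p0, C)" "(A, i0, B, p0, C) \<in> E"
    using 15(1) by (elim conf_cases)
  obtain f0 C' where f: "f = (C', f0, C)" by (rule arrow_ex [of f "arrow_src f" C]) (use 15 e in simp_all)
  have "adm_epic E B C p0" "C' \<in> X" "f0 \<in> mod_hom R C' C"
    using e 15 f by (auto simp: adm_epic_def)
  then obtain B' p1 f1 where po: "B' \<in> X" "is_pullback R X B C B' C' p0 f0 p1 f1" "adm_epic E B' C' p1"
    using adm_epic_pullback by blast
  then obtain k K where k: "(K, k, B', p1, C') \<in> E"
    by (auto simp: adm_epic_def)
  have "pullback p f (B', p1, C') (B', f1, B)"
    unfolding e f by (rule pullback_modules) (use po seqD [OF e(3)] 15 f in simp_all)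
  moreover have "arrow_conf E (K, k, B') (B', p1, C')" using k by simp
  ultimately show ?case by blast
next
  case (16 A B)
  then have "\<exists>P\<in>X. biproduct R A B P"
    using exact_subcategory by (simp add: exact_subcategory_def additive_subcategory_def)
  then obtain P where "P \<in> X" "biproduct R A B P" by blast
  then show ?case using biprod_modules 16 by blast
qed (auto elim!: conf_cases simp: seqD arrow_zero_def)

text \<open>The conditions on objects and the universal properties mention only \<open>X\<close>, so
  they carry over from \<open>E\<close>; the axioms of the substructure supply the memberships in
  \<open>E'\<close>.\<close>

lemma exact_subcategory_of_substructure:
  assumes "exact_substructure X (is_arrow R X) arrow_src arrow_tgt arrow_cmp arrow_one arrow_zero
    arrow_add arrow_neg (arrow_conf E) (arrow_conf E')"
  shows "exact_subcategory R X E'"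
proof -
  interpret S: exact_substructure X "is_arrow R X" arrow_src arrow_tgt arrow_cmp arrow_one arrow_zero
    arrow_add arrow_neg "arrow_conf E" "arrow_conf E'"
    by (rule assms)
  have sub: "(A, i, B, p, C) \<in> E" if "(A, i, B, p, C) \<in> E'" for A i B p C
    using S.sub_conf [of "(A, i, B)" "(B, p, C)"] that by simp
  then have subset: "E' \<subseteq> E" by auto
  have "exact_structure R X E'"
    unfolding exact_structure_def
  proof (intro conjI ballI allI impI; (elim conjE)?)
    show "kernel_cokernel_pair R X \<sigma>" if "\<sigma> \<in> E'" for \<sigma>
      using seq_kernel_cokernel subset that by blast
  next
    fix \<sigma> \<tau> assume 1: "\<sigma> \<in> E'" "seq_in R X \<tau>" "seq_isomorphic R \<sigma> \<tau>"
    then have \<tau>: "\<tau> \<in> E" using seq_iso subset by blast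
    obtain A i B p C where \<sigma>_eq: "\<sigma> = (A, i, B, p, C)" by (rule prod_cases5)
    obtain A' i' B' p' C' where \<tau>_eq: "\<tau> = (A', i', B', p', C')" by (rule prod_cases5)
    obtain a b c where abc: "a \<in> mod_iso R A A'" "b \<in> mod_iso R B B'" "c \<in> mod_iso R C C'"
      "compose (carrier A) b i = compose (carrier A) i' a" "compose (carrier B) c p = compose (carrier B) p' b"
      using 1(3) by (auto simp: seq_isomorphic_def \<sigma>_eq \<tau>_eq)
    note t = seqD [OF subset [THEN subsetD, OF 1(1) [unfolded \<sigma>_eq]]] seqD [OF \<tau> [unfolded \<tau>_eq]]
    obtain a' where a': "inverses (A, a, A') a'" by (rule mod_iso_inverses [OF abc(1)]) (use t in simp_all)
    obtain b' where b': "inverses (B, b, B') b'" by (rule mod_iso_inverses [OF abc(2)]) (use t in simp_all)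
    obtain c' where c': "inverses (C, c, C') c'" by (rule mod_iso_inverses [OF abc(3)]) (use t in simp_all)
    have "arrow_conf E' (A', i', B') (B', p', C')"
      by (rule S.sub_iso [of "(A, i, B)" "(B, p, C)", OF _ _ a' b' c'])
        (use 1 \<tau> abc(4,5) in \<open>simp_all add: \<sigma>_eq \<tau>_eq\<close>)
    then show "\<tau> \<in> E'" by (simp add: \<tau>_eq)
  next
    fix A assume "A \<in> X"
    then obtain p where "arrow_conf E' (A, id_hom A, A) p"
      using S.sub_one(1) [of A] by (auto simp: arrow_one_def)
    then show "adm_monic E' A A (id_hom A)"
      by (cases p) (auto simp: adm_monic_def)
  next
    fix A assume "A \<in> X"
    then obtain i where "arrow_conf E' i (A, id_hom A, A)"
      using S.sub_one(2) [of A] by (auto simp: arrow_one_def)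
    then show "adm_epic E' A A (id_hom A)"
      by (cases i) (auto simp: adm_epic_def)
  next
    fix A B C f g assume "adm_monic E' A B f" "adm_monic E' B C g"
    then obtain p P q Q where "arrow_conf E' (A, f, B) (B, p, P)" "arrow_conf E' (B, g, C) (C, q, Q)"
      by (auto simp: adm_monic_def)
    from S.sub_mono_cmp [OF this] obtain r where "arrow_conf E' (A, compose (carrier A) g f, C) r"
      by auto
    then show "adm_monic E' A C (compose (carrier A) g f)"
      by (cases r) (auto simp: adm_monic_def)
  next
    fix A B C f g assume "adm_epic E' A B f" "adm_epic E' B C g"
    then obtain k K l L where "arrow_conf E' (K, k, A) (A, f, B)" "arrow_conf E' (L, l, B) (B, g, C)"
      by (auto simp: adm_epic_def)
    from S.sub_epi_cmp [OF this] obtain r where "arrow_conf E' r (A, compose (carrier A) g f, C)"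
      by auto
    then show "adm_epic E' A C (compose (carrier A) g f)"
      by (cases r) (auto simp: adm_epic_def)
  next
    fix A B i A' f assume 1: "adm_monic E' A B i" "A' \<in> X" "f \<in> mod_hom R A A'"
    then obtain p C where s: "(A, i, B, p, C) \<in> E'" by (auto simp: adm_monic_def)
    note t = seqD [OF sub [OF s]]
    have "adm_monic E A B i" using sub [OF s] by (auto simp: adm_monic_def)
    \<comment> \<open>The square is taken from \<open>E\<close>; below, \<open>sub_pushout\<close>
      upgrades its inflation to \<open>E'\<close>.\<close>
    then obtain B' i' f' where po: "B' \<in> X" "is_pushout R X A B A' B' i f i' f'"
      using adm_monic_pushout 1(2,3) by blast
    have "pushout (A, i, B) (A, f, A') (A', i', B') (B, f', B')"
      by (rule pushout_modules) (use po t 1 in simp_all)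
    moreover have "arrow_conf E' (A, i, B) (B, p, C)" using s by simp
    ultimately obtain q where "arrow_conf E' (A', i', B') q"
      using S.sub_pushout by blast
    then have "adm_monic E' A' B' i'" by (cases q) (auto simp: adm_monic_def)
    then show "\<exists>B'\<in>X. \<exists>i' f'. is_pushout R X A B A' B' i f i' f' \<and> adm_monic E' A' B' i'"
      using po by blast
  next
    fix B C p C' f assume 1: "adm_epic E' B C p" "C' \<in> X" "f \<in> mod_hom R C' C"
    then obtain i A where s: "(A, i, B, p, C) \<in> E'" by (auto simp: adm_epic_def)
    note t = seqD [OF sub [OF s]]
    have "adm_epic E B C p" using sub [OF s] by (auto simp: adm_epic_def)
    then obtain B' p' f' where po: "B' \<in> X" "is_pullback R X B C B' C' p f p' f'"
      using adm_epic_pullback 1(2,3) by blast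
    have "pullback (B, p, C) (C', f, C) (B', p', C') (B', f', B)"
      by (rule pullback_modules) (use po t 1 in simp_all)
    moreover have "arrow_conf E' (A, i, B) (B, p, C)" using s by simp
    ultimately obtain k where "arrow_conf E' k (B', p', C')"
      using S.sub_pullback by blast
    then have "adm_epic E' B' C' p'" by (cases k) (auto simp: adm_epic_def)
    then show "\<exists>B'\<in>X. \<exists>p' f'. is_pullback R X B C B' C' p f p' f' \<and> adm_epic E' B' C' p'"
      using po by blast
  qed
  moreover have "\<forall>\<sigma>\<in>E'. seq_in R X \<sigma> \<and> short_exact R \<sigma>"
    using exact_subcategory subset unfolding exact_subcategory_def by blast
  ultimately show ?thesis
    using exact_subcategory by (simp add: exact_subcategory_def)
qed

section \<open>Functors of either variance on an exact subcategory\<close>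

fun arrow_map ::
  "(('r, 'm) module \<Rightarrow> ('r, 'm) module \<Rightarrow> ('m \<Rightarrow> 'm) \<Rightarrow> ('n \<Rightarrow> 'n)) \<Rightarrow> ('r, 'm) mod_arrow \<Rightarrow> 'n \<Rightarrow> 'n" where
  "arrow_map Gm (A, f, B) = Gm A B f"

lemma exact_subcategory_covariant:
  fixes Go :: "('r, 'm) module \<Rightarrow> ('r, 'n) module"
  assumes additive: "additive_covariant R X (fl R) Go Gm" and half: "half_exact E (covariant_image Go Gm)"
  shows "exact_subcategory R X (exact_part R E (covariant_image Go Gm))"
proof -
  have modG: "module R (Go M)" if "M \<in> X" for M
    using additive that by (auto simp: additive_covariant_def fl_def fin_gen_module_def)
  have grp: "abelian_group (Go M)" if "M \<in> X" for M
    using modG [OF that] by (rule module.axioms)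
  have hom: "Gm M N f \<in> mod_hom R (Go M) (Go N)" if "M \<in> X" "N \<in> X" "f \<in> mod_hom R M N" for M N f
    using additive that by (simp add: additive_covariant_def)
  note homD = mod_homD(1,3) [OF hom]
  have one: "Gm M M (id_hom M) = id_hom (Go M)" if "M \<in> X" for M
    using additive that by (simp add: additive_covariant_def)
  have cmp: "Gm L N (compose (carrier L) g f) = compose (carrier (Go L)) (Gm M N g) (Gm L M f)"
    if "L \<in> X" "M \<in> X" "N \<in> X" "f \<in> mod_hom R L M" "g \<in> mod_hom R M N" for L M N f g
    using additive that by (simp add: additive_covariant_def)
  have add: "Gm M N (add_hom M N f g) = add_hom (Go M) (Go N) (Gm M N f) (Gm M N g)"
    if "M \<in> X" "N \<in> X" "f \<in> mod_hom R M N" "g \<in> mod_hom R M N" for M N f g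
    using additive that by (simp add: additive_covariant_def)
  have exact: "Gm A B i ` carrier (Go A) = {x \<in> carrier (Go B). Gm B C p x = \<zero>\<^bsub>Go C\<^esub>}"
    if "(A, i, B, p, C) \<in> E" for A i B p C
  proof -
    have "exact_middle (covariant_image Go Gm (A, i, B, p, C))"
      using half that unfolding half_exact_def by blast
    then show ?thesis by (simp add: a_kernel_def')
  qed
  interpret G: half_exact_functor X "is_arrow R X" arrow_src arrow_tgt arrow_cmp arrow_one arrow_zero
    arrow_add arrow_neg "arrow_conf E" Go "arrow_map Gm"
  proof (intro half_exact_functor.intro half_exact_functor_axioms.intro exact_cat_axioms, goal_cases)
    case (1 A)
    then show ?case by (rule grp)
  next
    case (2 f x)
    then show ?case by (cases f) (simp add: homD)
  next
    case (3 f x y)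
    then show ?case by (cases f) (simp add: homD)
  next
    case (4 x A)
    then show ?case by (simp add: arrow_one_def one, simp add: id_hom_def)
  next
    case (5 f g x)
    obtain A f0 B where f: "f = (A, f0, B)" by (rule prod_cases3)
    obtain g0 C where g: "g = (B, g0, C)"
      by (rule arrow_ex [of g B "arrow_tgt g"]) (use 5 f in simp_all)
    show ?case using 5 by (simp add: f g cmp [of A B C] compose_eq)
  next
    case (6 f g x)
    then show ?case by (cases f; cases g) (simp add: add, simp add: add_hom_def)
  next
    case (7 i p)
    then show ?case by (cases i; cases p) (simp add: exact)
  qed
  have "G.gexact i p \<longleftrightarrow> arrow_conf (exact_part R E (covariant_image Go Gm)) i p" for i p
  proof -
    obtain A i0 B where i: "i = (A, i0, B)" by (rule prod_cases3)
    obtain B' p0 C where p: "p = (B', p0, C)" by (rule prod_cases3)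
    \<comment> \<open>Middle exactness is half-exactness and the typing is functoriality, so only
      the conditions at the two ends remain; these are the ones in \<open>gexact\<close>.\<close>
    have "short_exact R (covariant_image Go Gm (A, i0, B, p0, C)) \<longleftrightarrow>
        inj_on (Gm A B i0) (carrier (Go A)) \<and> Gm B C p0 ` carrier (Go B) = carrier (Go C)"
      if "(A, i0, B, p0, C) \<in> E"
      using modG hom seqD(1-5) [OF that] by (simp add: exact [OF that] a_kernel_def')
    then show ?thesis
      by (auto simp: G.gexact_def i p exact_part_def)
  qed
  then have "G.gexact = arrow_conf (exact_part R E (covariant_image Go Gm))"
    by (simp add: fun_eq_iff)
  with exact_subcategory_of_substructure G.gexact_substructure show ?thesis by metis
qed

lemma exact_subcategory_contravariant:
  fixes Go :: "('r, 'm) module \<Rightarrow> ('r, 'n) module"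
  assumes additive: "additive_contravariant R X (fl R) Go Gm" and half: "half_exact E (contravariant_image Go Gm)"
  shows "exact_subcategory R X (exact_part R E (contravariant_image Go Gm))"
proof -
  have modG: "module R (Go M)" if "M \<in> X" for M
    using additive that by (auto simp: additive_contravariant_def fl_def fin_gen_module_def)
  have grp: "abelian_group (Go M)" if "M \<in> X" for M
    using modG [OF that] by (rule module.axioms)
  have hom: "Gm M N f \<in> mod_hom R (Go N) (Go M)" if "M \<in> X" "N \<in> X" "f \<in> mod_hom R M N" for M N f
    using additive that by (simp add: additive_contravariant_def)
  note homD = mod_homD(1,3) [OF hom]
  have one: "Gm M M (id_hom M) = id_hom (Go M)" if "M \<in> X" for M
    using additive that by (simp add: additive_contravariant_def)
  have cmp: "Gm L N (compose (carrier L) g f) = compose (carrier (Go N)) (Gm L M f) (Gm M N g)"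
    if "L \<in> X" "M \<in> X" "N \<in> X" "f \<in> mod_hom R L M" "g \<in> mod_hom R M N" for L M N f g
    using additive that by (simp add: additive_contravariant_def)
  have add: "Gm M N (add_hom M N f g) = add_hom (Go N) (Go M) (Gm M N f) (Gm M N g)"
    if "M \<in> X" "N \<in> X" "f \<in> mod_hom R M N" "g \<in> mod_hom R M N" for M N f g
    using additive that by (simp add: additive_contravariant_def)
  have exact: "Gm B C p ` carrier (Go C) = {x \<in> carrier (Go B). Gm A B i x = \<zero>\<^bsub>Go A\<^esub>}"
    if "(A, i, B, p, C) \<in> E" for A i B p C
  proof -
    have "exact_middle (contravariant_image Go Gm (A, i, B, p, C))"
      using half that unfolding half_exact_def by blast
    then show ?thesis by (simp add: a_kernel_def')
  qed
  interpret op: exact_cat X "is_arrow R X" arrow_tgt arrow_src "\<lambda>g f. arrow_cmp f g" arrow_one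
    "\<lambda>A B. arrow_zero B A" arrow_add arrow_neg "\<lambda>p i. arrow_conf E i p"
    by (rule op)
  \<comment> \<open>With source and target exchanged, the same \<open>arrow_map Gm\<close> acts
    covariantly, and the conflation starts with \<open>p\<close>.\<close>
  interpret G: half_exact_functor X "is_arrow R X" arrow_tgt arrow_src "\<lambda>g f. arrow_cmp f g" arrow_one
    "\<lambda>A B. arrow_zero B A" arrow_add arrow_neg "\<lambda>p i. arrow_conf E i p" Go "arrow_map Gm"
  proof (intro half_exact_functor.intro half_exact_functor_axioms.intro op.exact_cat_axioms, goal_cases)
    case (1 A)
    then show ?case by (rule grp)
  next
    case (2 f x)
    then show ?case by (cases f) (simp add: homD)
  next
    case (3 f x y)
    then show ?case by (cases f) (simp add: homD)
  next
    case (4 x A)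
    then show ?case by (simp add: arrow_one_def one, simp add: id_hom_def)
  next
    case (5 f g x)
    obtain A f0 B where f: "f = (A, f0, B)" by (rule prod_cases3)
    obtain g0 C where g: "g = (C, g0, A)"
      by (rule arrow_ex [of g "arrow_src g" A]) (use 5 f in simp_all)
    show ?case using 5 by (simp add: f g cmp [of C A B] compose_eq)
  next
    case (6 f g x)
    then show ?case by (cases f; cases g) (simp add: add, simp add: add_hom_def)
  next
    case (7 i p)
    then show ?case by (cases i; cases p) (simp add: exact)
  qed
  have "G.gexact p i \<longleftrightarrow> arrow_conf (exact_part R E (contravariant_image Go Gm)) i p" for i p
  proof -
    obtain A i0 B where i: "i = (A, i0, B)" by (rule prod_cases3)
    obtain B' p0 C where p: "p = (B', p0, C)" by (rule prod_cases3)
    have "short_exact R (contravariant_image Go Gm (A, i0, B, p0, C)) \<longleftrightarrow>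
        inj_on (Gm B C p0) (carrier (Go C)) \<and> Gm A B i0 ` carrier (Go B) = carrier (Go A)"
      if "(A, i0, B, p0, C) \<in> E"
      using modG hom seqD(1-5) [OF that] by (simp add: exact [OF that] a_kernel_def')
    then show ?thesis
      by (auto simp: G.gexact_def i p exact_part_def)
  qed
  then have "(\<lambda>i p. G.gexact p i) = arrow_conf (exact_part R E (contravariant_image Go Gm))"
    by (simp add: fun_eq_iff)
  \<comment> \<open>Dualising the substructure of the opposite category returns to the original
    category, since reversing twice changes nothing.\<close>
  with exact_subcategory_of_substructure exact_substructure_dual [OF G.gexact_substructure]
  show ?thesis by simp
qed

end

theorem corollary4p13:
  fixes R :: "('r, 'x) ring_scheme"
    and X :: "('r, 'm) module set"
    and E :: "('r, 'm) mod_seq set"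
    and Go :: "('r, 'm) module \<Rightarrow> ('r, 'n) module"
    and Gm :: "('r, 'm) module \<Rightarrow> ('r, 'm) module \<Rightarrow> ('m \<Rightarrow> 'm) \<Rightarrow> ('n \<Rightarrow> 'n)"
  assumes "cring R" and "noetherian_ring R"
    and "exact_subcategory R X E"
  shows "(additive_covariant R X (fl R) Go Gm \<and> half_exact E (covariant_image Go Gm) \<longrightarrow>
            exact_subcategory R X (exact_part R E (covariant_image Go Gm))) \<and>
         (additive_contravariant R X (fl R) Go Gm \<and> half_exact E (contravariant_image Go Gm) \<longrightarrow>
            exact_subcategory R X (exact_part R E (contravariant_image Go Gm)))"
proof -
  interpret module_exact_cat R X E
    by unfold_locales (rule assms(3))
  show ?thesis
    using exact_subcategory_covariant exact_subcategory_contravariant by blast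
qed

end
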